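(* Let $n\ge 2$ and $\delta>0$. There exists a constant $C=C(n,\delta)$, depending only on $n$ and $\delta$, such that the following holds. Let $R>2$ and let $\Sigma^n\subset\mathbf{R}^{n+1}$ be any smooth properly embedded self-shrinker such that $H\ge\delta$ on $B_R\cap\Sigma$. Then $$|A|(x)\le \frac{CR}{R-|x|}\,H(x)\qquad\text{for all }x\in B_{R-1}\cap\Sigma .$$
   Context: For a smooth hypersurface $\Sigma^n\subset\mathbf{R}^{n+1}$ (without boundary), $x$ denotes the position vector, $\mathbf{n}$ the outward unit normal (a smooth global choice of unit normal field), $A$ the second fundamental form, $|A|$ its norm, and $H=\mathrm{div}_\Sigma\,\mathbf{n}$ the mean curvature (so round spheres have $H>0$ with respect to the outward normal). $\Sigma$ is a self-shrinker (or shrinker) if $H=\tfrac12\langle x,\mathbf{n}\rangle$ on $\Sigma$. $B_R$ denotes the closed ball of radius $R$ in $\mathbf{R}^{n+1}$ centered at the origin. *)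

theory Defs
  imports "HOL-Analysis.Analysis"
begin

text \<open>Smoothness, to be used on open sets \<open>U\<close> only.\<close>

fun Ck_on :: "nat \<Rightarrow> 'a::real_normed_vector set \<Rightarrow> ('a \<Rightarrow> 'b::real_normed_vector) \<Rightarrow> bool" where
  "Ck_on 0 U f \<longleftrightarrow> continuous_on U f"
| "Ck_on (Suc k) U f \<longleftrightarrow>
     (\<forall>x\<in>U. f differentiable (at x)) \<and>
     (\<forall>v. Ck_on k U (\<lambda>x. frechet_derivative f (at x) v))"

definition smooth_on :: "'a::real_normed_vector set \<Rightarrow> ('a \<Rightarrow> 'b::real_normed_vector) \<Rightarrow> bool" where
  "smooth_on U f \<longleftrightarrow> (\<forall>k. Ck_on k U f)"

text \<open>Smoothness along an arbitrary subset: local existence of smooth extensions.\<close>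

definition smooth_along :: "'a::real_normed_vector set \<Rightarrow> ('a \<Rightarrow> 'b::real_normed_vector) \<Rightarrow> bool" where
  "smooth_along S f \<longleftrightarrow>
     (\<forall>p\<in>S. \<exists>U F. open U \<and> p \<in> U \<and> smooth_on U F \<and> (\<forall>x\<in>S \<inter> U. F x = f x))"

text \<open>Embedded hypersurfaces without boundary (possibly empty or disconnected), by the slice
  condition: near each of its points, \<open>S\<close> is mapped to a hyperplane by an ambient diffeomorphism.\<close>

definition smooth_hypersurface :: "'a::euclidean_space set \<Rightarrow> bool" where
  "smooth_hypersurface S \<longleftrightarrow>
     (\<forall>p\<in>S. \<exists>(U :: 'a set) (V :: 'a set) \<phi> \<psi>. \<exists>b\<in>Basis.
        open U \<and> p \<in> U \<and> open V \<and> homeomorphism U V \<phi> \<psi> \<and>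
        smooth_on U \<phi> \<and> smooth_on V \<psi> \<and> \<phi> ` (S \<inter> U) = {y \<in> V. y \<bullet> b = 0})"

text \<open>For an embedded submanifold, properness of the inclusion map.\<close>

definition properly_embedded :: "'a::euclidean_space set \<Rightarrow> bool" where
  "properly_embedded S \<longleftrightarrow> (\<forall>K. compact K \<longrightarrow> compact (S \<inter> K))"

definition tangent_space :: "'a::euclidean_space set \<Rightarrow> 'a \<Rightarrow> 'a set" where
  "tangent_space S p =
     {v. \<exists>\<epsilon>>0. \<exists>\<gamma>. smooth_on {-\<epsilon><..<\<epsilon>} \<gamma> \<and> \<gamma> ` {-\<epsilon><..<\<epsilon>} \<subseteq> S \<and> \<gamma> 0 = p \<and>
           (\<gamma> has_vector_derivative v) (at (0::real))}"

definition unit_normal_field :: "'a::euclidean_space set \<Rightarrow> ('a \<Rightarrow> 'a) \<Rightarrow> bool" where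
  "unit_normal_field S \<nu> \<longleftrightarrow> smooth_along S \<nu> \<and>
     (\<forall>p\<in>S. norm (\<nu> p) = 1 \<and> (\<forall>v\<in>tangent_space S p. \<nu> p \<bullet> v = 0))"

text \<open>A chosen orthonormal basis of the tangent space; the traces and norms below do not depend on
  the choice.\<close>

definition orthonormal_basis :: "'a::euclidean_space set \<Rightarrow> 'a set \<Rightarrow> bool" where
  "orthonormal_basis T E \<longleftrightarrow>
     E \<subseteq> T \<and> span E = T \<and> pairwise orthogonal E \<and> (\<forall>e\<in>E. norm e = 1)"

definition tangent_frame :: "'a::euclidean_space set \<Rightarrow> 'a \<Rightarrow> 'a set" where
  "tangent_frame S p = (SOME E. orthonormal_basis (tangent_space S p) E)"

text \<open>The derivative along \<open>S\<close> of a map on \<open>S\<close>, to be applied to tangent vectors only: the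
  derivative within \<open>S\<close> leaves the values off \<open>tangent_space S p\<close> unspecified but determines those
  on it, where it agrees with the derivative of any smooth local extension of \<open>f\<close>.\<close>

definition deriv_along :: "'a::euclidean_space set \<Rightarrow> ('a \<Rightarrow> 'b::real_normed_vector) \<Rightarrow> 'a \<Rightarrow> 'a \<Rightarrow> 'b" where
  "deriv_along S f p = frechet_derivative f (at p within S)"

text \<open>\<open>A(v, w) = \<langle>D\<^sub>v W, \<nu>\<rangle> = -\<langle>D\<^sub>v \<nu>, w\<rangle>\<close>, where \<open>W\<close> is any tangential extension of \<open>w\<close>.\<close>

definition second_ff :: "'a::euclidean_space set \<Rightarrow> ('a \<Rightarrow> 'a) \<Rightarrow> 'a \<Rightarrow> 'a \<Rightarrow> 'a \<Rightarrow> real" where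
  "second_ff S \<nu> p v w = - (deriv_along S \<nu> p v \<bullet> w)"

definition norm_second_ff :: "'a::euclidean_space set \<Rightarrow> ('a \<Rightarrow> 'a) \<Rightarrow> 'a \<Rightarrow> real" where
  "norm_second_ff S \<nu> p =
     sqrt (\<Sum>e\<in>tangent_frame S p. \<Sum>e'\<in>tangent_frame S p. (second_ff S \<nu> p e e')\<^sup>2)"

definition div_along :: "'a::euclidean_space set \<Rightarrow> ('a \<Rightarrow> 'a) \<Rightarrow> 'a \<Rightarrow> real" where
  "div_along S X p = (\<Sum>e\<in>tangent_frame S p. deriv_along S X p e \<bullet> e)"

definition mean_curvature :: "'a::euclidean_space set \<Rightarrow> ('a \<Rightarrow> 'a) \<Rightarrow> 'a \<Rightarrow> real" where
  "mean_curvature S \<nu> p = div_along S \<nu> p"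

text \<open>This condition is invariant under \<open>\<nu> \<mapsto> -\<nu>\<close>, but the sign of the mean curvature is not.\<close>

definition self_shrinker :: "'a::euclidean_space set \<Rightarrow> ('a \<Rightarrow> 'a) \<Rightarrow> bool" where
  "self_shrinker S \<nu> \<longleftrightarrow> (\<forall>x\<in>S. mean_curvature S \<nu> x = (x \<bullet> \<nu> x) / 2)"

end

theory Submission
  imports Defs
begin

text \<open>
  Write \<open>h\<close> for the second fundamental form, \<open>a = |A|\<^sup>2\<close>, \<open>c = \<delta> / 2\<close>, \<open>K = H - c\<close>, \<open>\<eta> = R\<^sup>2 - |x|\<^sup>2\<close>
  and \<open>L = \<Delta> - \<langle>x, \<nabla> \<cdot>\<rangle> / 2\<close>. On a shrinker \<open>L H = H / 2 - a H\<close> and, by Simons' identity,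
  \<open>L a = a - 2 a\<^sup>2 + 2 |\<nabla>A|\<^sup>2\<close>. Replacing \<open>H\<close> by \<open>H - c\<close> makes the reaction terms of \<open>a / K\<^sup>2\<close> leave
  behind \<open>2 a c / K\<close> times this quotient. At a maximum point of \<open>a \<eta>\<^sup>2 / K\<^sup>2\<close> on the compact set
  \<open>\<Sigma> \<inter> B\<^sub>R\<close> this good term absorbs the contributions of the cutoff \<open>\<eta>\<close>, the cross term being controlled by
  \<open>\<nabla>H = h(x) / 2\<close>; hence \<open>a \<eta>\<^sup>2 \<le> C R\<^sup>4 K\<^sup>2\<close> everywhere.

  The computations use tangential derivatives \<open>\<delta>\<^sub>i F = DF(e\<^sub>i - \<langle>N, e\<^sub>i\<rangle> N)\<close> along the ambient basis, \<open>N\<close> being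
  any smooth local extension of the normal: on \<open>\<Sigma>\<close> they depend on \<open>F\<close> restricted to \<open>\<Sigma>\<close> only, so
  no intrinsic connection is needed. The commutator of \<open>\<delta>\<^sub>i\<close> and \<open>\<delta>\<^sub>j\<close> applied to the components of
  \<open>N\<close> is the Codazzi equation.
\<close>

section \<open>Smooth functions\<close>

lemma Ck_on_Suc_has_derivative:
  "Ck_on (Suc k) U f \<Longrightarrow> x \<in> U \<Longrightarrow> (f has_derivative frechet_derivative f (at x)) (at x)"
  using frechet_derivative_works by auto

lemma Ck_on_Suc_frechet: "Ck_on (Suc k) U f \<Longrightarrow> Ck_on k U (\<lambda>x. frechet_derivative f (at x) v)"
  by simp

text \<open>A derivative computed by rules agrees with \<open>frechet_derivative\<close> only at
  points of \<open>U\<close>, so \<open>Ck_on k U\<close> must be insensitive to values off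
  \<open>U\<close>. This is a hypothesis here because \<open>Ck_on_cong\<close> is itself proved by
  induction through this lemma; \<open>Ck_on_SucI\<close> then discharges it.\<close>

lemma Ck_on_Suc_cong_I:
  fixes f :: "'a::real_normed_vector \<Rightarrow> 'b::real_normed_vector"
  assumes "open U" "\<And>x. x \<in> U \<Longrightarrow> (f has_derivative f' x) (at x)" "\<And>v. Ck_on k U (\<lambda>x. f' x v)"
    and cong: "\<And>f g :: 'a \<Rightarrow> 'b. (\<And>x. x \<in> U \<Longrightarrow> f x = g x) \<Longrightarrow> Ck_on k U f \<Longrightarrow> Ck_on k U g"
  shows "Ck_on (Suc k) U f"
proof -
  have "f' x = frechet_derivative f (at x)" if "x \<in> U" for x
    using assms(2)[OF that] by (rule frechet_derivative_at)
  then have "f' x v = frechet_derivative f (at x) v" if "x \<in> U" for x v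
    using that by metis
  then have "Ck_on k U (\<lambda>x. frechet_derivative f (at x) v)" for v
    by (rule cong[OF _ assms(3)])
  moreover have "f differentiable at x" if "x \<in> U" for x
    using assms(2)[OF that] by (rule differentiableI)
  ultimately show ?thesis by simp
qed

lemma Ck_on_cong:
  assumes "open U" "\<And>x. x \<in> U \<Longrightarrow> f x = g x" "Ck_on k U f"
  shows "Ck_on k U g"
  using assms(2,3)
proof (induction k arbitrary: f g)
  case 0
  then show ?case by (simp cong: continuous_on_cong)
next
  case (Suc k)
  have "(g has_derivative frechet_derivative f (at x)) (at x)" if "x \<in> U" for x
    using has_derivative_transform_within_open[OF Ck_on_Suc_has_derivative[OF Suc.prems(2) that] assms(1) that]
      Suc.prems(1) by blast
  then show ?case
    by (rule Ck_on_Suc_cong_I[OF assms(1) _ Ck_on_Suc_frechet[OF Suc.prems(2)] Suc.IH])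
qed

lemmas Ck_on_SucI = Ck_on_Suc_cong_I[OF _ _ _ Ck_on_cong]

lemma Ck_on_subset: "Ck_on k U f \<Longrightarrow> V \<subseteq> U \<Longrightarrow> Ck_on k V f"
proof (induction k arbitrary: f)
  case 0
  then show ?case by (auto intro: continuous_on_subset)
next
  case (Suc k)
  then show ?case by auto
qed

lemma Ck_on_SucD: "Ck_on (Suc k) U f \<Longrightarrow> Ck_on k U f"
proof (induction k arbitrary: f)
  case 0
  then show ?case
    by (auto intro!: continuous_at_imp_continuous_on differentiable_imp_continuous_within)
next
  case (Suc k)
  then show ?case by (metis Ck_on.simps(2))
qed

lemma Ck_on_const: "Ck_on k U (\<lambda>x. c)"
  by (induction k arbitrary: c) auto

lemma Ck_on_add: "open U \<Longrightarrow> Ck_on k U f \<Longrightarrow> Ck_on k U g \<Longrightarrow> Ck_on k U (\<lambda>x. f x + g x)"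
proof (induction k arbitrary: f g)
  case 0
  then show ?case by (auto intro: continuous_on_add)
next
  case (Suc k)
  show ?case
    by (rule Ck_on_SucI[OF Suc.prems(1)
          has_derivative_add[OF Suc.prems(2,3)[THEN Ck_on_Suc_has_derivative]]
          Suc.IH[OF Suc.prems(1) Suc.prems(2,3)[THEN Ck_on_Suc_frechet]] Suc.prems(1)])
qed

lemma Ck_on_linear:
  "bounded_linear L \<Longrightarrow> open U \<Longrightarrow> Ck_on k U f \<Longrightarrow> Ck_on k U (\<lambda>x. L (f x))"
proof (induction k arbitrary: f)
  case 0
  then show ?case using bounded_linear.continuous_on by (metis Ck_on.simps(1))
next
  case (Suc k)
  show ?case
    by (rule Ck_on_SucI[OF Suc.prems(2)
          bounded_linear.has_derivative[OF Suc.prems(1) Ck_on_Suc_has_derivative[OF Suc.prems(3)]]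
          Suc.IH[OF Suc.prems(1,2) Ck_on_Suc_frechet[OF Suc.prems(3)]] Suc.prems(2)])
qed

text \<open>Each term of the product rule pairs a derivative with an undifferentiated factor, which
  \<open>Ck_on_SucD\<close> lowers to the order of the induction hypothesis.\<close>

lemma Ck_on_bilinear:
  assumes B: "bounded_bilinear B" and U: "open U"
  shows "Ck_on k U f \<Longrightarrow> Ck_on k U g \<Longrightarrow> Ck_on k U (\<lambda>x. B (f x) (g x))"
proof (induction k arbitrary: f g)
  case 0
  then show ?case using bounded_bilinear.continuous_on[OF B] by (metis Ck_on.simps(1))
next
  case (Suc k)
  show ?case
  proof (rule Ck_on_SucI[OF U bounded_bilinear.FDERIV[OF B
            Suc.prems[THEN Ck_on_Suc_has_derivative]] _ U])
    fix v
    show "Ck_on k U (\<lambda>x. B (f x) (frechet_derivative g (at x) v) + B (frechet_derivative f (at x) v) (g x))"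
      by (rule Ck_on_add[OF U Suc.IH[OF Ck_on_SucD[OF Suc.prems(1)] Ck_on_Suc_frechet[OF Suc.prems(2)]]
            Suc.IH[OF Ck_on_Suc_frechet[OF Suc.prems(1)] Ck_on_SucD[OF Suc.prems(2)]]])
  qed
qed

text \<open>Serves to show that straight lines read in a chart are smooth curves, as
  \<open>tangent_space\<close> demands. The derivative of the composition is a multiple of the same
  composition for the derivative of \<open>f\<close> in the fixed direction \<open>w\<close>, so the
  induction closes.\<close>

lemma Ck_on_affine:
  fixes f :: "'a::real_normed_vector \<Rightarrow> 'b::real_normed_vector" and V :: "real set"
  assumes "open V" "\<And>t. t \<in> V \<Longrightarrow> x + t *\<^sub>R w \<in> U"
  shows "Ck_on k U f \<Longrightarrow> Ck_on k V (\<lambda>t. f (x + t *\<^sub>R w))"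
proof (induction k arbitrary: f)
  case 0
  have "continuous_on V (f \<circ> (\<lambda>t. x + t *\<^sub>R w))"
    using 0 assms by (intro continuous_on_compose continuous_intros) (auto intro: continuous_on_subset)
  then show ?case by (simp add: o_def)
next
  case (Suc k)
  have D1: "((\<lambda>t. f (x + t *\<^sub>R w)) has_derivative (\<lambda>s. s *\<^sub>R frechet_derivative f (at (x + t *\<^sub>R w)) w)) (at t)"
    if "t \<in> V" for t
  proof -
    have f: "(f has_derivative frechet_derivative f (at (x + t *\<^sub>R w))) (at (x + t *\<^sub>R w))"
      by (rule Ck_on_Suc_has_derivative[OF Suc.prems assms(2)[OF that]])
    have "((\<lambda>t. x + t *\<^sub>R w) has_derivative (\<lambda>s. s *\<^sub>R w)) (at t)"
      by (auto intro!: derivative_eq_intros)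
    from diff_chain_at[OF this f] show ?thesis
      by (simp add: o_def linear_cmul[OF has_derivative_linear[OF f]])
  qed
  show ?case
    by (rule Ck_on_SucI[OF assms(1) D1
          Ck_on_linear[OF bounded_linear_scaleR_right assms(1) Suc.IH[OF Ck_on_Suc_frechet[OF Suc.prems]]]
          assms(1)])
qed

section \<open>Closure rules for smooth functions\<close>

named_theorems smooth_intros

lemma smooth_on_subset: "smooth_on U f \<Longrightarrow> V \<subseteq> U \<Longrightarrow> smooth_on V f"
  by (auto simp: smooth_on_def intro: Ck_on_subset)

lemma smooth_on_const [smooth_intros]: "smooth_on U (\<lambda>x. c)"
  by (simp add: smooth_on_def Ck_on_const)

lemma smooth_on_ident: "smooth_on U (\<lambda>x. x)"
  unfolding smooth_on_def
proof
  fix k show "Ck_on k U (\<lambda>x. x)" by (cases k) (auto simp: Ck_on_const)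
qed

lemma smooth_on_linear:
  "bounded_linear L \<Longrightarrow> open U \<Longrightarrow> smooth_on U f \<Longrightarrow> smooth_on U (\<lambda>x. L (f x))"
  by (auto simp: smooth_on_def intro: Ck_on_linear)

lemma smooth_on_add [smooth_intros]:
  "open U \<Longrightarrow> smooth_on U f \<Longrightarrow> smooth_on U g \<Longrightarrow> smooth_on U (\<lambda>x. f x + g x)"
  by (auto simp: smooth_on_def intro: Ck_on_add)

lemma smooth_on_mult [smooth_intros]:
  fixes f g :: "'a::real_normed_vector \<Rightarrow> real"
  shows "open U \<Longrightarrow> smooth_on U f \<Longrightarrow> smooth_on U g \<Longrightarrow> smooth_on U (\<lambda>x. f x * g x)"
  by (auto simp: smooth_on_def intro: Ck_on_bilinear[OF bounded_bilinear_mult])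

lemma smooth_on_inner [smooth_intros]:
  fixes f g :: "'a::real_normed_vector \<Rightarrow> 'b::real_inner"
  shows "open U \<Longrightarrow> smooth_on U f \<Longrightarrow> smooth_on U g \<Longrightarrow> smooth_on U (\<lambda>x. f x \<bullet> g x)"
  by (auto simp: smooth_on_def intro: Ck_on_bilinear[OF bounded_bilinear_inner])

lemma smooth_on_minus [smooth_intros]:
  "open U \<Longrightarrow> smooth_on U f \<Longrightarrow> smooth_on U (\<lambda>x. - f x)"
  using smooth_on_linear[OF bounded_linear_minus[OF bounded_linear_ident]] .

lemma smooth_on_diff [smooth_intros]:
  "open U \<Longrightarrow> smooth_on U f \<Longrightarrow> smooth_on U g \<Longrightarrow> smooth_on U (\<lambda>x. f x - g x)"
  using smooth_on_add[OF _ _ smooth_on_minus, of U f g] by simp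

lemma smooth_on_sum [smooth_intros]:
  "open U \<Longrightarrow> (\<And>i. i \<in> I \<Longrightarrow> smooth_on U (f i)) \<Longrightarrow> smooth_on U (\<lambda>x. \<Sum>i\<in>I. f i x)"
  by (induction I rule: infinite_finite_induct) (auto intro!: smooth_on_const smooth_on_add)

lemma smooth_on_power [smooth_intros]:
  fixes f :: "'a::real_normed_vector \<Rightarrow> real"
  shows "open U \<Longrightarrow> smooth_on U f \<Longrightarrow> smooth_on U (\<lambda>x. f x ^ m)"
  by (induction m) (auto intro: smooth_on_const smooth_on_mult)

lemma smooth_on_frechet [smooth_intros]:
  "smooth_on U f \<Longrightarrow> smooth_on U (\<lambda>x. frechet_derivative f (at x) v)"
  unfolding smooth_on_def by (metis Ck_on.simps(2))

lemma smooth_on_imp_continuous_on: "smooth_on U f \<Longrightarrow> continuous_on U f"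
  unfolding smooth_on_def by (metis Ck_on.simps(1))

lemma smooth_on_imp_differentiable: "smooth_on U f \<Longrightarrow> x \<in> U \<Longrightarrow> f differentiable at x"
  unfolding smooth_on_def by (metis Ck_on.simps(2))

lemma smooth_on_has_derivative:
  "smooth_on U f \<Longrightarrow> x \<in> U \<Longrightarrow> (f has_derivative frechet_derivative f (at x)) (at x)"
  using frechet_derivative_works smooth_on_imp_differentiable by blast

lemma smooth_on_linear_frechet:
  "smooth_on U f \<Longrightarrow> x \<in> U \<Longrightarrow> linear (frechet_derivative f (at x))"
  using smooth_on_has_derivative has_derivative_linear by blast

lemma frechet_eqI:
  "(f has_derivative f') (at x) \<Longrightarrow> frechet_derivative f (at x) v = f' v"
  using frechet_derivative_at by metis

section \<open>Symmetry of second derivatives\<close>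

lemma smooth_on_line_DERIV:
  fixes f :: "'a::real_normed_vector \<Rightarrow> real"
  assumes "smooth_on U f" "x + t *\<^sub>R w \<in> U"
  shows "((\<lambda>t. f (x + t *\<^sub>R w)) has_real_derivative frechet_derivative f (at (x + t *\<^sub>R w)) w) (at t)"
proof -
  have f: "(f has_derivative frechet_derivative f (at (x + t *\<^sub>R w))) (at (x + t *\<^sub>R w))"
    using assms by (rule smooth_on_has_derivative)
  have "((\<lambda>t. x + t *\<^sub>R w) has_derivative (\<lambda>s. s *\<^sub>R w)) (at t)"
    by (auto intro!: derivative_eq_intros)
  from diff_chain_at[OF this f] show ?thesis
    by (simp add: o_def linear_cmul[OF has_derivative_linear[OF f]] has_field_derivative_def mult_commute_abs)
qed

text \<open>The second difference is an increment of \<open>\<phi>\<close>. The mean value theorem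
  in direction \<open>u\<close>, then in direction \<open>v\<close>, turns it into an iterated
  derivative at a nearby point; the bound on \<open>t\<close> keeps the parallelogram inside the
  ball.\<close>

lemma mixed_partial_mvt:
  fixes f :: "'a::real_normed_vector \<Rightarrow> real"
  assumes f: "smooth_on (ball x e) f" and t: "t > 0" "t * (norm u + norm v) < e"
  shows "\<exists>y\<in>ball x e. f (x + t *\<^sub>R u + t *\<^sub>R v) - f (x + t *\<^sub>R u) - f (x + t *\<^sub>R v) + f x =
     t * t * frechet_derivative (\<lambda>y. frechet_derivative f (at y) u) (at y) v"
proof -
  have inb: "x + s *\<^sub>R u + r *\<^sub>R v \<in> ball x e" if "0 \<le> s" "s \<le> t" "0 \<le> r" "r \<le> t" for s r
  proof -
    have "norm (s *\<^sub>R u + r *\<^sub>R v) \<le> s * norm u + r * norm v"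
      using norm_triangle_ineq[of "s *\<^sub>R u" "r *\<^sub>R v"] that by simp
    also have "\<dots> \<le> t * norm u + t * norm v"
      using that by (intro add_mono mult_right_mono) auto
    finally have "norm (s *\<^sub>R u + r *\<^sub>R v) < e" using t(2) by (simp add: algebra_simps)
    moreover have "x - (x + s *\<^sub>R u + r *\<^sub>R v) = - (s *\<^sub>R u + r *\<^sub>R v)" by simp
    ultimately show ?thesis by (simp only: mem_ball dist_norm norm_minus_cancel)
  qed
  define \<phi> where "\<phi> = (\<lambda>s. f (x + t *\<^sub>R v + s *\<^sub>R u) - f (x + s *\<^sub>R u))"
  define Du where "Du = (\<lambda>y. frechet_derivative f (at y) u)"
  have "(\<phi> has_real_derivative (Du (x + t *\<^sub>R v + s *\<^sub>R u) - Du (x + s *\<^sub>R u))) (at s)"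
    if "0 \<le> s" "s \<le> t" for s
    unfolding \<phi>_def Du_def using inb[of s 0] inb[of s t] that t(1)
    by (intro DERIV_diff smooth_on_line_DERIV[OF f]) (auto simp: algebra_simps)
  from MVT2[OF t(1) this] obtain s where s: "0 < s" "s < t"
    "\<phi> t - \<phi> 0 = (t - 0) * (Du (x + t *\<^sub>R v + s *\<^sub>R u) - Du (x + s *\<^sub>R u))" by blast
  have sDu: "smooth_on (ball x e) Du" unfolding Du_def by (rule smooth_on_frechet[OF f])
  have "((\<lambda>r. Du (x + s *\<^sub>R u + r *\<^sub>R v)) has_real_derivative
      frechet_derivative Du (at (x + s *\<^sub>R u + r *\<^sub>R v)) v) (at r)"
    if "0 \<le> r" "r \<le> t" for r
    using inb[of s r] that s by (intro smooth_on_line_DERIV[OF sDu]) auto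
  from MVT2[OF t(1) this] obtain r where r: "0 < r" "r < t"
    "Du (x + s *\<^sub>R u + t *\<^sub>R v) - Du (x + s *\<^sub>R u + 0 *\<^sub>R v) = (t - 0) * frechet_derivative Du (at (x + s *\<^sub>R u + r *\<^sub>R v)) v"
    by blast
  have "\<phi> t - \<phi> 0 = t * t * frechet_derivative Du (at (x + s *\<^sub>R u + r *\<^sub>R v)) v"
    using s(3) r(3) by (simp add: algebra_simps)
  moreover have "\<phi> t - \<phi> 0 = f (x + t *\<^sub>R u + t *\<^sub>R v) - f (x + t *\<^sub>R u) - f (x + t *\<^sub>R v) + f x"
    by (simp add: \<phi>_def algebra_simps)
  ultimately show ?thesis using inb[of s r] s r unfolding Du_def by (intro bexI[of _ "x + s *\<^sub>R u + r *\<^sub>R v"]) auto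
qed

text \<open>The second difference is symmetric in \<open>u\<close> and \<open>v\<close>. Evaluating
  it in both orders gives \<open>P y = Q z\<close> with \<open>y\<close> and \<open>z\<close> close
  to \<open>x\<close>, which continuity forbids if \<open>P x\<close> and \<open>Q x\<close>
  differ.\<close>

lemma mixed_partials_commute:
  fixes f :: "'a::real_normed_vector \<Rightarrow> real"
  assumes U: "open U" "x \<in> U" and f: "smooth_on U f"
  shows "frechet_derivative (\<lambda>y. frechet_derivative f (at y) u) (at x) v =
    frechet_derivative (\<lambda>y. frechet_derivative f (at y) v) (at x) u"
proof (rule ccontr)
  define P where "P = (\<lambda>y. frechet_derivative (\<lambda>y. frechet_derivative f (at y) u) (at y) v)"
  define Q where "Q = (\<lambda>y. frechet_derivative (\<lambda>y. frechet_derivative f (at y) v) (at y) u)"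
  assume "\<not> ?thesis"
  then have d: "\<bar>P x - Q x\<bar> / 2 > 0" by (simp add: P_def Q_def)
  have "smooth_on U P" "smooth_on U Q" unfolding P_def Q_def by (intro smooth_intros f)+
  then have c: "isCont P x" "isCont Q x"
    using U by (auto dest!: smooth_on_imp_continuous_on simp: continuous_on_eq_continuous_at)
  obtain e1 where e1: "e1 > 0" "\<And>y. dist y x < e1 \<Longrightarrow> dist (P y) (P x) < \<bar>P x - Q x\<bar> / 2"
    using c(1) d unfolding continuous_at_eps_delta dist_norm by metis
  obtain e2 where e2: "e2 > 0" "\<And>y. dist y x < e2 \<Longrightarrow> dist (Q y) (Q x) < \<bar>P x - Q x\<bar> / 2"
    using c(2) d unfolding continuous_at_eps_delta dist_norm by metis
  obtain e3 where e3: "e3 > 0" "ball x e3 \<subseteq> U" using U open_contains_ball by blast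
  define e where "e = min e1 (min e2 e3)"
  have e: "e > 0" "ball x e \<subseteq> U" using e1 e2 e3 by (auto simp: e_def)
  \<comment> \<open>The summand 1 keeps the denominator positive when both directions
    vanish.\<close>
  define t where "t = e / (2 * (norm u + norm v + 1))"
  have np: "norm u + norm v + 1 > 0" by (simp add: add_nonneg_pos)
  have t: "t > 0" using e np by (simp add: t_def)
  have "t * (norm u + norm v) < t * (2 * (norm u + norm v + 1))" using t np
    by (intro mult_strict_left_mono) auto
  also have "\<dots> = e" using np by (simp add: t_def)
  finally have te: "t * (norm u + norm v) < e" .
  have fb: "smooth_on (ball x e) f" using f e smooth_on_subset by blast
  obtain y where y: "y \<in> ball x e" "f (x + t *\<^sub>R u + t *\<^sub>R v) - f (x + t *\<^sub>R u) - f (x + t *\<^sub>R v) + f x = t * t * P y"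
    using mixed_partial_mvt[OF fb t te] unfolding P_def by blast
  obtain z where z: "z \<in> ball x e" "f (x + t *\<^sub>R v + t *\<^sub>R u) - f (x + t *\<^sub>R v) - f (x + t *\<^sub>R u) + f x = t * t * Q z"
    using mixed_partial_mvt[OF fb t, of v u] te unfolding Q_def by (auto simp: add.commute)
  have "t * t * P y = t * t * Q z" using y(2) z(2) by (simp add: algebra_simps)
  then have "P y = Q z" using t by simp
  moreover have "dist (P y) (P x) < \<bar>P x - Q x\<bar> / 2" "dist (Q z) (Q x) < \<bar>P x - Q x\<bar> / 2"
    using y(1) z(1) e1(2)[of y] e2(2)[of z] by (simp_all add: e_def dist_commute)
  ultimately show False unfolding dist_norm real_norm_def by argo
qed

section \<open>Tangential calculus on a hypersurface\<close>

lemma smooth_on_cong: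
  assumes "open U" "\<And>x. x \<in> U \<Longrightarrow> f x = g x" "smooth_on U f"
  shows "smooth_on U g"
proof -
  have "Ck_on k U g" for k
    using assms(3) by (intro Ck_on_cong[OF assms(1,2)]) (simp_all add: smooth_on_def)
  then show ?thesis by (simp add: smooth_on_def)
qed

lemma frechet_derivative_Basis_sum:
  fixes F :: "'a::euclidean_space \<Rightarrow> real"
  assumes "smooth_on U F" "x \<in> U"
  shows "frechet_derivative F (at x) v = (\<Sum>b\<in>Basis. (v \<bullet> b) * frechet_derivative F (at x) b)"
proof -
  have "frechet_derivative F (at x) (\<Sum>b\<in>Basis. (v \<bullet> b) *\<^sub>R b) = (\<Sum>b\<in>Basis. (v \<bullet> b) * frechet_derivative F (at x) b)"
    using smooth_on_linear_frechet[OF assms] by (simp add: linear_sum linear_cmul)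
  then show ?thesis by (simp add: euclidean_representation)
qed

text \<open>\<open>N\<close> is an extension of the normal that is unit on \<open>S\<close> only.
  \<open>f\<close> is a local defining function of \<open>S\<close>; it carries the second order
  information behind the symmetry of \<open>h\<close> and the maximum principle.\<close>

locale hypersurface_patch =
  fixes S U :: "'a::euclidean_space set" and N :: "'a \<Rightarrow> 'a" and f :: "'a \<Rightarrow> real"
  assumes open_U: "open U"
    and smooth_N: "smooth_on U N"
    and smooth_f: "smooth_on U f"
    and N1: "\<And>x. x \<in> S \<inter> U \<Longrightarrow> N x \<bullet> N x = 1"
    and tangent: "\<And>x. x \<in> S \<inter> U \<Longrightarrow> tangent_space S x = {v. N x \<bullet> v = 0}"
    and f_eq_0: "\<And>x. x \<in> S \<inter> U \<Longrightarrow> f x = 0"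
    and f_deriv_N: "\<And>x. x \<in> S \<inter> U \<Longrightarrow> frechet_derivative f (at x) (N x) \<noteq> 0"
begin

definition proj :: "'a \<Rightarrow> 'a \<Rightarrow> 'a" where
  "proj x v = v - (N x \<bullet> v) *\<^sub>R N x"

definition d :: "'a \<Rightarrow> ('a \<Rightarrow> real) \<Rightarrow> 'a \<Rightarrow> real" where
  "d i F x = frechet_derivative F (at x) (proj x i)"

definition n :: "'a \<Rightarrow> 'a \<Rightarrow> real" where
  "n i x = N x \<bullet> i"

text \<open>On tangent vectors this is the negative of \<open>second_ff\<close>, so that its trace
  is the divergence of the normal; norms are unaffected by the sign.\<close>

definition h :: "'a \<Rightarrow> 'a \<Rightarrow> 'a \<Rightarrow> real" where
  "h i j = d i (n j)"

lemma smooth_n [smooth_intros]: "smooth_on U (n i)"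
  unfolding n_def by (intro smooth_intros open_U smooth_N)

lemma smooth_frechet_N [smooth_intros]:
  fixes F :: "'a \<Rightarrow> real"
  assumes "smooth_on U F"
  shows "smooth_on U (\<lambda>x. frechet_derivative F (at x) (N x))"
proof (rule smooth_on_cong[OF open_U])
  show "smooth_on U (\<lambda>x. \<Sum>b\<in>Basis. n b x * frechet_derivative F (at x) b)"
    by (intro smooth_intros open_U assms)
qed (simp add: frechet_derivative_Basis_sum[OF assms, of _ "N _"] n_def)

lemma d_eq:
  assumes "smooth_on U F" "x \<in> U"
  shows "d i F x = frechet_derivative F (at x) i - n i x * frechet_derivative F (at x) (N x)"
  using smooth_on_linear_frechet[OF assms]
  by (simp add: d_def proj_def n_def linear_diff linear_cmul)

lemma smooth_d [smooth_intros]: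
  assumes "smooth_on U F"
  shows "smooth_on U (d i F)"
proof (rule smooth_on_cong[OF open_U])
  show "smooth_on U (\<lambda>x. frechet_derivative F (at x) i - n i x * frechet_derivative F (at x) (N x))"
    by (intro smooth_intros open_U assms)
qed (simp add: d_eq[OF assms])

lemma smooth_h [smooth_intros]: "smooth_on U (h i j)"
  unfolding h_def by (intro smooth_intros)

lemma smooth_coord [smooth_intros]: "smooth_on U (\<lambda>x. x \<bullet> i)"
  by (intro smooth_intros open_U smooth_on_ident)

lemma proj_tangent: "x \<in> S \<inter> U \<Longrightarrow> N x \<bullet> proj x v = 0"
  using N1 by (simp add: proj_def inner_diff_right)

text \<open>A curve in \<open>S\<close> through \<open>x\<close> with velocity \<open>v\<close>
  exists because \<open>v\<close> is tangent, and \<open>F\<close> vanishes along it near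
  \<open>x\<close>.\<close>

lemma tangent_deriv_zero:
  assumes F: "smooth_on U F" "\<And>y. y \<in> S \<inter> U \<Longrightarrow> F y = (0::real)"
    and x: "x \<in> S \<inter> U" "N x \<bullet> v = 0"
  shows "frechet_derivative F (at x) v = 0"
proof -
  obtain \<epsilon> \<gamma> where \<gamma>: "\<epsilon> > 0" "\<gamma> ` {-\<epsilon><..<\<epsilon>} \<subseteq> S" "\<gamma> 0 = x" "(\<gamma> has_vector_derivative v) (at (0::real))"
  proof -
    have "v \<in> tangent_space S x" using tangent[OF x(1)] x(2) by simp
    then show thesis using that unfolding tangent_space_def by blast
  qed
  have D: "(F has_derivative frechet_derivative F (at (\<gamma> 0))) (at (\<gamma> 0))"
    using smooth_on_has_derivative[OF F(1)] x \<gamma>(3) by auto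
  have D1: "((F \<circ> \<gamma>) has_vector_derivative frechet_derivative F (at x) v) (at 0)"
    using vector_derivative_diff_chain_within[OF \<gamma>(4), of F "frechet_derivative F (at x)"] D \<gamma>(3)
    by (auto intro: has_derivative_at_withinI)
  have "continuous (at 0) \<gamma>" using \<gamma>(4) has_vector_derivative_continuous by blast
  then have "\<forall>\<^sub>F t in at 0. \<gamma> t \<in> U"
    using open_U x \<gamma>(3) by (intro topological_tendstoD[of \<gamma> x]) (auto simp: continuous_at)
  moreover have "\<forall>\<^sub>F t in at (0::real). t \<in> {-\<epsilon><..<\<epsilon>}"
    using \<gamma>(1) by (intro eventually_at_in_open') auto
  ultimately have ev: "\<forall>\<^sub>F t in at 0. (F \<circ> \<gamma>) t = 0"
  proof eventually_elim
    case (elim t)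
    then have "\<gamma> t \<in> S \<inter> U" using \<gamma>(2) by blast
    then show ?case using F(2) by simp
  qed
  have "((\<lambda>_. 0) has_vector_derivative frechet_derivative F (at x) v) (at (0::real))"
    using has_derivative_transform_eventually[OF D1[unfolded has_vector_derivative_def] ev]
      F(2) x(1) \<gamma>(3) unfolding has_vector_derivative_def by auto
  then show ?thesis using vector_derivative_unique_at has_vector_derivative_const by blast
qed

text \<open>Allows identities that hold on \<open>S\<close> only, such as
  \<open>N \<bullet> N = 1\<close> or the shrinker equation, to be differentiated tangentially.
  Every later geometric computation rests on this.\<close>

lemma d_cong:
  assumes "smooth_on U F" "smooth_on U G" "\<And>y. y \<in> S \<inter> U \<Longrightarrow> F y = G y" "x \<in> S \<inter> U"
  shows "d i F x = d i G x"
proof -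
  have "smooth_on U (\<lambda>y. F y - G y)" by (intro smooth_intros open_U assms)
  then have "frechet_derivative (\<lambda>y. F y - G y) (at x) (proj x i) = 0"
    using assms by (intro tangent_deriv_zero proj_tangent) auto
  moreover have "((\<lambda>y. F y - G y) has_derivative
      (\<lambda>v. frechet_derivative F (at x) v - frechet_derivative G (at x) v)) (at x)"
    using assms by (intro has_derivative_diff smooth_on_has_derivative[of U]) auto
  ultimately show ?thesis by (simp add: d_def frechet_eqI)
qed

lemma d_const [simp]: "d i (\<lambda>y. c) x = 0"
  by (simp add: d_def)

lemma d_coord: "d i (\<lambda>y. y \<bullet> j) x = i \<bullet> j - n i x * n j x"
proof -
  have "((\<lambda>y. y \<bullet> j) has_derivative (\<lambda>v. v \<bullet> j)) (at x)" by (auto intro!: derivative_eq_intros)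
  then show ?thesis by (simp add: d_def frechet_eqI proj_def n_def inner_diff_left)
qed

context
  fixes F G :: "'a \<Rightarrow> real" and x :: 'a
  assumes FG: "smooth_on U F" "smooth_on U G" "x \<in> U"
begin

lemma d_add: "d i (\<lambda>y. F y + G y) x = d i F x + d i G x"
  unfolding d_def
  by (rule frechet_eqI has_derivative_add smooth_on_has_derivative FG)+

lemma d_diff: "d i (\<lambda>y. F y - G y) x = d i F x - d i G x"
  unfolding d_def
  by (rule frechet_eqI has_derivative_diff smooth_on_has_derivative FG)+

lemma d_mult: "d i (\<lambda>y. F y * G y) x = d i F x * G x + F x * d i G x"
proof -
  have "((\<lambda>y. F y * G y) has_derivative
      (\<lambda>v. F x * frechet_derivative G (at x) v + frechet_derivative F (at x) v * G x)) (at x)"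
    by (intro has_derivative_mult smooth_on_has_derivative[of U] FG)
  then show ?thesis by (simp add: d_def frechet_eqI)
qed

end

lemma d_cmult: "smooth_on U F \<Longrightarrow> x \<in> U \<Longrightarrow> d i (\<lambda>y. c * F y) x = c * d i F x"
  using d_mult[of "\<lambda>_. c" F x i] by (simp add: smooth_on_const)

lemma d_power2: "smooth_on U F \<Longrightarrow> x \<in> U \<Longrightarrow> d i (\<lambda>y. (F y)\<^sup>2) x = 2 * F x * d i F x"
  using d_mult[of F F x i] by (simp add: power2_eq_square)

lemma d_sum:
  assumes "\<And>k. k \<in> I \<Longrightarrow> smooth_on U (F k)" "x \<in> U"
  shows "d i (\<lambda>y. \<Sum>k\<in>I. F k y) x = (\<Sum>k\<in>I. d i (F k) x)"
  using assms
proof (induction I rule: infinite_finite_induct)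
  case (insert k I)
  then show ?case
    using d_add[of "F k" "\<lambda>y. \<Sum>k\<in>I. F k y" x i] by (simp add: smooth_on_sum[OF open_U])
qed simp_all

text \<open>The numbers \<open>d k F x\<close> are the components of the tangential gradient, which
  is orthogonal to \<open>N x\<close>.\<close>

lemma normal_d:
  assumes "smooth_on U F" "x \<in> S \<inter> U"
  shows "(\<Sum>k\<in>Basis. n k x * d k F x) = 0"
proof -
  have "(\<Sum>k\<in>Basis. n k x * d k F x) =
      (\<Sum>k\<in>Basis. (N x \<bullet> k) * frechet_derivative F (at x) k)
       - (\<Sum>k\<in>Basis. (N x \<bullet> k) * (N x \<bullet> k)) * frechet_derivative F (at x) (N x)"
    using assms by (simp add: d_eq[of F] n_def algebra_simps sum_subtractf sum_distrib_left)
  also have "\<dots> = 0"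
    using assms N1 by (simp add: frechet_derivative_Basis_sum[of U F x "N x"] flip: euclidean_inner[of "N x" "N x"])
  finally show ?thesis .
qed

lemma sum_n_square: "x \<in> S \<inter> U \<Longrightarrow> (\<Sum>k\<in>Basis. n k x * n k x) = 1"
  using N1 by (simp add: n_def euclidean_inner[symmetric])

lemma h_eq:
  assumes "x \<in> U"
  shows "h i j x = frechet_derivative N (at x) (proj x i) \<bullet> j"
proof -
  have "((\<lambda>y. N y \<bullet> j) has_derivative (\<lambda>v. frechet_derivative N (at x) v \<bullet> j)) (at x)"
    by (intro has_derivative_inner_left smooth_on_has_derivative[OF smooth_N assms])
  then show ?thesis by (simp add: h_def d_def n_def [abs_def] frechet_eqI)
qed

text \<open>Obtained by differentiating \<open>N \<bullet> N = 1\<close> along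
  \<open>S\<close>.\<close>

lemma h_N:
  assumes x: "x \<in> S \<inter> U"
  shows "h i (N x) x = 0"
proof -
  have "d i (\<lambda>y. N y \<bullet> N y) x = d i (\<lambda>y. 1) x"
    using x by (intro d_cong smooth_intros open_U smooth_N N1) auto
  moreover have "((\<lambda>y. N y \<bullet> N y) has_derivative
      (\<lambda>v. N x \<bullet> frechet_derivative N (at x) v + frechet_derivative N (at x) v \<bullet> N x)) (at x)"
    using x by (intro has_derivative_inner smooth_on_has_derivative[OF smooth_N]) auto
  ultimately show ?thesis
    using x by (simp add: d_def h_eq frechet_eqI inner_commute)
qed

lemma h_linear: "x \<in> U \<Longrightarrow> h i v x = (\<Sum>j\<in>Basis. (v \<bullet> j) * h i j x)"
  by (simp add: h_eq euclidean_inner[of _ v] mult.commute)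

lemma h_n:
  assumes x: "x \<in> S \<inter> U"
  shows "(\<Sum>j\<in>Basis. n j x * h i j x) = 0"
  using h_N[OF x, of i] h_linear[of x i "N x"] x by (simp add: n_def)

text \<open>On \<open>S\<close> the gradient of \<open>f\<close> is a multiple of \<open>N\<close>, so \<open>h\<close> is proportional to the tangential
  part of the Hessian of \<open>f\<close>.\<close>

lemma h_sym:
  assumes x: "x \<in> S \<inter> U"
  shows "h i j x = h j i x"
proof -
  define \<mu> where "\<mu> = (\<lambda>y. frechet_derivative f (at y) (N y))"
  have smu: "smooth_on U \<mu>" unfolding \<mu>_def by (intro smooth_intros smooth_f)
  have grad: "frechet_derivative f (at y) w = n w y * \<mu> y" if y: "y \<in> S \<inter> U" for y w
  proof -
    have "frechet_derivative f (at y) (proj y w) = 0"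
      by (rule tangent_deriv_zero[OF smooth_f f_eq_0 y proj_tangent[OF y]])
    then show ?thesis
      using d_eq[OF smooth_f, of y w] y by (simp add: d_def \<mu>_def)
  qed
  have hess: "frechet_derivative (\<lambda>y. frechet_derivative f (at y) w) (at x) (proj x i) = h i w x * \<mu> x"
    if "N x \<bullet> w = 0" for i w
  proof -
    have "d i (\<lambda>y. frechet_derivative f (at y) w) x = d i (\<lambda>y. n w y * \<mu> y) x"
      using x by (intro d_cong smooth_intros open_U smu smooth_f grad) auto
    also have "\<dots> = h i w x * \<mu> x"
      using x that d_mult[OF smooth_n smu, of x i w] by (simp add: h_def n_def)
    finally show ?thesis by (simp add: d_def)
  qed
  have h_proj: "h i (proj x j) x = h i j x" for i j
    using x h_N[OF x, of i] by (simp add: h_eq proj_def[of x j] inner_diff_right)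
  have "h i (proj x j) x * \<mu> x = h j (proj x i) x * \<mu> x"
    using mixed_partials_commute[OF open_U _ smooth_f, of x "proj x j" "proj x i"] x
    by (simp add: hess proj_tangent)
  then show ?thesis using f_deriv_N[OF x] by (simp add: h_proj \<mu>_def)
qed

text \<open>Separates the ambient Hessian in the directions frozen at \<open>x\<close>, which is
  symmetric, from the terms that arise because the projection moves with the point. At an ambient
  critical point only the Hessian remains.\<close>

lemma dd_eq:
  assumes F: "smooth_on U F" and x: "x \<in> S \<inter> U"
  shows "d i (d j F) x =
    frechet_derivative (\<lambda>y. frechet_derivative F (at y) (proj x j)) (at x) (proj x i)
    - h i j x * frechet_derivative F (at x) (N x)
    - n j x * (\<Sum>k\<in>Basis. h i k x * frechet_derivative F (at x) k)"
proof -
  have xU: "x \<in> U" using x by simp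
  \<comment> \<open>\<open>G\<close> is the derivative of \<open>F\<close> in the varying direction
    \<open>N\<close>, expanded so that the product rule applies.\<close>
  define G where "G = (\<lambda>y. \<Sum>b\<in>Basis. n b y * frechet_derivative F (at y) b)"
  have sG: "smooth_on U G" unfolding G_def by (intro smooth_intros open_U F)
  have sD: "smooth_on U (\<lambda>y. frechet_derivative F (at y) w)" for w by (intro smooth_intros F)
  have G: "frechet_derivative F (at y) (N y) = G y" if "y \<in> U" for y
    using that by (simp add: G_def n_def frechet_derivative_Basis_sum[OF F, of y "N y"])
  have "d i (d j F) x = d i (\<lambda>y. frechet_derivative F (at y) j - n j y * G y) x"
    using x by (intro d_cong smooth_intros open_U F sG) (auto simp: d_eq[OF F] G)
  also have "\<dots> = d i (\<lambda>y. frechet_derivative F (at y) j) x - (h i j x * G x + n j x * d i G x)"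
    using xU by (simp add: d_diff[OF sD smooth_on_mult[OF open_U smooth_n sG]] d_mult[OF smooth_n sG] h_def)
  also have "d i G x = (\<Sum>b\<in>Basis. h i b x * frechet_derivative F (at x) b + n b x * d i (\<lambda>y. frechet_derivative F (at y) b) x)"
    unfolding G_def using xU
    by (subst d_sum) (auto intro!: smooth_intros open_U F sum.cong simp: d_mult[OF smooth_n sD] h_def)
  also have "\<dots> = (\<Sum>b\<in>Basis. h i b x * frechet_derivative F (at x) b) + (\<Sum>b\<in>Basis. n b x * d i (\<lambda>y. frechet_derivative F (at y) b) x)"
    by (rule sum.distrib)
  \<comment> \<open>The second order terms of \<open>G\<close> recombine into a derivative in the
    direction \<open>N x\<close>, now held constant; with the term for \<open>j\<close> they form
    the direction \<open>proj x j\<close>.\<close>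
  also have "(\<Sum>b\<in>Basis. n b x * d i (\<lambda>y. frechet_derivative F (at y) b) x) = d i (\<lambda>y. frechet_derivative F (at y) (N x)) x"
  proof -
    have "d i (\<lambda>y. frechet_derivative F (at y) (N x)) x = d i (\<lambda>y. \<Sum>b\<in>Basis. n b x * frechet_derivative F (at y) b) x"
      using x by (intro d_cong smooth_intros open_U F) (auto simp: n_def frechet_derivative_Basis_sum[OF F, of _ "N x"])
    also have "\<dots> = (\<Sum>b\<in>Basis. n b x * d i (\<lambda>y. frechet_derivative F (at y) b) x)"
      using xU by (simp add: d_sum smooth_intros open_U F d_cmult[OF sD])
    finally show ?thesis ..
  qed
  finally have 1: "d i (d j F) x = d i (\<lambda>y. frechet_derivative F (at y) j) x
      - n j x * d i (\<lambda>y. frechet_derivative F (at y) (N x)) x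
      - h i j x * G x - n j x * (\<Sum>b\<in>Basis. h i b x * frechet_derivative F (at x) b)"
    by (simp add: algebra_simps)
  have "d i (\<lambda>y. frechet_derivative F (at y) (proj x j)) x = d i (\<lambda>y. frechet_derivative F (at y) j - n j x * frechet_derivative F (at y) (N x)) x"
    using x
    by (intro d_cong smooth_intros open_U F)
       (auto simp: proj_def n_def linear_diff linear_cmul smooth_on_linear_frechet[OF F])
  also have "\<dots> = d i (\<lambda>y. frechet_derivative F (at y) j) x - n j x * d i (\<lambda>y. frechet_derivative F (at y) (N x)) x"
    using xU by (simp add: d_diff[OF sD smooth_on_mult[OF open_U smooth_on_const sD]] d_cmult[OF sD])
  finally show ?thesis using 1 G[OF xU] by (simp add: d_def)
qed

text \<open>In \<open>dd_eq\<close> the Hessian and the term with \<open>h i j\<close> are symmetric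
  and cancel. In what is left, ambient derivatives may be replaced by \<open>d k F\<close> because
  \<open>h\<close> annihilates the normal.\<close>

lemma d_commutator:
  assumes F: "smooth_on U F" and x: "x \<in> S \<inter> U"
  shows "d i (d j F) x - d j (d i F) x =
    n i x * (\<Sum>k\<in>Basis. h j k x * d k F x) - n j x * (\<Sum>k\<in>Basis. h i k x * d k F x)"
proof -
  have hd: "(\<Sum>k\<in>Basis. h i k x * d k F x) = (\<Sum>k\<in>Basis. h i k x * frechet_derivative F (at x) k)" for i
  proof -
    have "(\<Sum>k\<in>Basis. h i k x * d k F x) = (\<Sum>k\<in>Basis. h i k x * frechet_derivative F (at x) k)
       - (\<Sum>k\<in>Basis. n k x * h i k x) * frechet_derivative F (at x) (N x)"
      using x by (simp add: d_eq[OF F] algebra_simps sum_subtractf sum_distrib_left)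
    then show ?thesis using h_n[OF x, of i] by simp
  qed
  show ?thesis
    using mixed_partials_commute[OF open_U _ F, of x "proj x j" "proj x i"] x h_sym[OF x, of i j]
    by (simp add: dd_eq[OF F x] hd)
qed

section \<open>Maximum principle on the hypersurface\<close>

lemma tangent_curve_nonpos:
  assumes Q: "smooth_on U Q" "\<And>y. y \<in> S \<inter> U \<Longrightarrow> Q y \<le> (0::real)"
    and p: "p \<in> S \<inter> U" "Q p = 0" and v: "N p \<bullet> v = 0"
  obtains \<epsilon> \<gamma> where "\<epsilon> > 0" "smooth_on {-\<epsilon><..<\<epsilon>} \<gamma>" "\<gamma> 0 = p" "(\<gamma> has_vector_derivative v) (at (0::real))"
    "\<And>t. t \<in> {-\<epsilon><..<\<epsilon>} \<Longrightarrow> \<gamma> t \<in> S \<inter> U" "\<And>t. t \<in> {-\<epsilon><..<\<epsilon>} \<Longrightarrow> Q (\<gamma> t) \<le> 0"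
proof -
  obtain \<epsilon> \<gamma> where \<gamma>: "\<epsilon> > 0" "smooth_on {-\<epsilon><..<\<epsilon>} \<gamma>" "\<gamma> ` {-\<epsilon><..<\<epsilon>} \<subseteq> S" "\<gamma> 0 = p" "(\<gamma> has_vector_derivative v) (at (0::real))"
  proof -
    have "v \<in> tangent_space S p" using tangent[OF p(1)] v by simp
    then show thesis using that unfolding tangent_space_def by blast
  qed
  have "isCont \<gamma> 0" using \<gamma>(5) has_vector_derivative_continuous by blast
  moreover obtain \<delta> where "\<delta> > 0" "ball p \<delta> \<subseteq> U"
    using open_U p(1) open_contains_ball by blast
  ultimately obtain r where r: "r > 0" "\<And>t. dist t 0 < r \<Longrightarrow> dist (\<gamma> t) (\<gamma> 0) < \<delta>"
    unfolding continuous_at_eps_delta by blast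
  then have r: "r > 0" "\<And>t. dist t 0 < r \<Longrightarrow> \<gamma> t \<in> U"
    using \<gamma>(4) \<open>ball p \<delta> \<subseteq> U\<close> by (auto simp: dist_commute)
  define e where "e = min \<epsilon> r"
  show thesis
  proof (rule that[of e \<gamma>])
    show "e > 0" using \<gamma>(1) r(1) by (simp add: e_def)
    show "smooth_on {-e<..<e} \<gamma>" using \<gamma>(2) by (rule smooth_on_subset) (auto simp: e_def)
    show in_SU: "\<gamma> t \<in> S \<inter> U" if "t \<in> {-e<..<e}" for t
      using that \<gamma>(3) r(2)[of t] by (force simp: e_def dist_norm)
    show "Q (\<gamma> t) \<le> 0" if "t \<in> {-e<..<e}" for t
      using Q(2) in_SU that by blast
  qed (use \<gamma> in auto)
qed

lemma d_eq_0_at_max: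
  assumes Q: "smooth_on U Q" "\<And>y. y \<in> S \<inter> U \<Longrightarrow> Q y \<le> (0::real)"
    and p: "p \<in> S \<inter> U" "Q p = 0" and v: "N p \<bullet> v = 0"
  shows "frechet_derivative Q (at p) v = 0"
proof -
  obtain \<epsilon> \<gamma> where \<gamma>: "\<epsilon> > 0" "\<gamma> 0 = p" "(\<gamma> has_vector_derivative v) (at (0::real))"
    "\<And>t. t \<in> {-\<epsilon><..<\<epsilon>} \<Longrightarrow> Q (\<gamma> t) \<le> 0"
    using tangent_curve_nonpos[OF assms] by metis
  have "((Q \<circ> \<gamma>) has_vector_derivative frechet_derivative Q (at p) v) (at 0)"
    using vector_derivative_diff_chain_within[OF \<gamma>(3), of Q "frechet_derivative Q (at p)"]
      smooth_on_has_derivative[OF Q(1), of p] p(1) \<gamma>(2)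
    by (auto intro: has_derivative_at_withinI)
  then have "((Q \<circ> \<gamma>) has_real_derivative frechet_derivative Q (at p) v) (at 0)"
    by (simp add: has_real_derivative_iff_has_vector_derivative)
  then show ?thesis
    by (rule DERIV_local_max[OF _ \<gamma>(1)]) (use \<gamma>(2,4) p in \<open>auto simp: abs_less_iff\<close>)
qed

text \<open>Since \<open>p\<close> is critical for \<open>Q\<close> in all ambient directions, the
  acceleration of the curve \<open>\<gamma>\<close> does not enter: the derivative of
  \<open>Q \<circ> \<gamma>\<close> divided by \<open>t\<close> tends to the Hessian value
  \<open>\<beta>\<close>. If \<open>\<beta> > 0\<close>, the mean value theorem makes
  \<open>Q\<close> positive at a nearby point of the curve.\<close>

lemma hessian_nonpos_at_critical_max:
  assumes Q: "smooth_on U Q" "\<And>y. y \<in> S \<inter> U \<Longrightarrow> Q y \<le> (0::real)"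
    and p: "p \<in> S \<inter> U" "Q p = 0" and v: "N p \<bullet> v = 0"
    and crit: "\<And>w. frechet_derivative Q (at p) w = 0"
  shows "frechet_derivative (\<lambda>y. frechet_derivative Q (at y) v) (at p) v \<le> 0"
proof (rule ccontr)
  obtain \<epsilon> \<gamma> where \<gamma>: "\<epsilon> > 0" "smooth_on {-\<epsilon><..<\<epsilon>} \<gamma>" "\<gamma> 0 = p" "(\<gamma> has_vector_derivative v) (at (0::real))"
    "\<And>t. t \<in> {-\<epsilon><..<\<epsilon>} \<Longrightarrow> \<gamma> t \<in> S \<inter> U" "\<And>t. t \<in> {-\<epsilon><..<\<epsilon>} \<Longrightarrow> Q (\<gamma> t) \<le> 0"
    using tangent_curve_nonpos[OF Q p v] by metis
  define \<beta> where "\<beta> = frechet_derivative (\<lambda>y. frechet_derivative Q (at y) v) (at p) v"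
  define D where "D b y = frechet_derivative Q (at y) b" for b y
  define \<gamma>' where "\<gamma>' t = frechet_derivative \<gamma> (at t) 1" for t
  have sD: "smooth_on U (D b)" for b unfolding D_def by (intro smooth_intros Q)
  have \<gamma>d: "(\<gamma> has_vector_derivative \<gamma>' t) (at t)" if "t \<in> {-\<epsilon><..<\<epsilon>}" for t
  proof -
    have "frechet_derivative \<gamma> (at t) s = s *\<^sub>R \<gamma>' t" for s
      using linear_cmul[OF smooth_on_linear_frechet[OF \<gamma>(2) that], of s 1] by (simp add: \<gamma>'_def)
    then have "frechet_derivative \<gamma> (at t) = (\<lambda>s. s *\<^sub>R \<gamma>' t)" by blast
    then show ?thesis
      using smooth_on_has_derivative[OF \<gamma>(2) that] by (simp add: has_vector_derivative_def)
  qed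
  have "\<gamma>' 0 = v"
    using vector_derivative_unique_at[OF \<gamma>d \<gamma>(4)] \<gamma>(1) by simp
  have "smooth_on {-\<epsilon><..<\<epsilon>} \<gamma>'" unfolding \<gamma>'_def by (intro smooth_intros \<gamma>(2))
  then have "isCont \<gamma>' 0"
    using \<gamma>(1) by (auto dest!: smooth_on_imp_continuous_on simp: continuous_on_eq_continuous_at)
  then have \<gamma>'_lim: "(\<gamma>' \<longlongrightarrow> v) (at 0)" using \<open>\<gamma>' 0 = v\<close> by (simp add: isCont_def)
  have q': "((Q \<circ> \<gamma>) has_real_derivative (\<Sum>b\<in>Basis. (\<gamma>' t \<bullet> b) * D b (\<gamma> t))) (at t)" if "t \<in> {-\<epsilon><..<\<epsilon>}" for t
  proof -
    have "((Q \<circ> \<gamma>) has_vector_derivative frechet_derivative Q (at (\<gamma> t)) (\<gamma>' t)) (at t)"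
      using vector_derivative_diff_chain_within[OF \<gamma>d[OF that], of Q "frechet_derivative Q (at (\<gamma> t))"]
        smooth_on_has_derivative[OF Q(1), of "\<gamma> t"] \<gamma>(5)[OF that]
      by (auto intro: has_derivative_at_withinI)
    then show ?thesis
      using frechet_derivative_Basis_sum[OF Q(1), of "\<gamma> t" "\<gamma>' t"] \<gamma>(5)[OF that]
      by (simp add: has_real_derivative_iff_has_vector_derivative D_def)
  qed
  \<comment> \<open>By \<open>crit\<close> the function \<open>D b\<close> vanishes at
    \<open>p\<close>, so this quotient is its difference quotient along
    \<open>\<gamma>\<close>.\<close>
  have Dlim: "((\<lambda>t. D b (\<gamma> t) / t) \<longlongrightarrow> frechet_derivative (D b) (at p) v) (at 0)" for b
  proof -
    have "((D b \<circ> \<gamma>) has_vector_derivative frechet_derivative (D b) (at p) v) (at 0)"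
      using vector_derivative_diff_chain_within[OF \<gamma>(4), of "D b" "frechet_derivative (D b) (at p)"]
        smooth_on_has_derivative[OF sD, of p b] p(1) \<gamma>(3)
      by (auto intro: has_derivative_at_withinI)
    then have "((D b \<circ> \<gamma>) has_real_derivative frechet_derivative (D b) (at p) v) (at 0)"
      by (simp add: has_real_derivative_iff_has_vector_derivative)
    then show ?thesis using crit \<gamma>(3) by (simp add: has_field_derivative_iff D_def)
  qed
  have "((\<lambda>t. \<Sum>b\<in>Basis. (\<gamma>' t \<bullet> b) * (D b (\<gamma> t) / t)) \<longlongrightarrow> (\<Sum>b\<in>Basis. (v \<bullet> b) * frechet_derivative (D b) (at p) v)) (at 0)"
    by (intro tendsto_intros \<gamma>'_lim Dlim)
  also have "(\<Sum>b\<in>Basis. (v \<bullet> b) * frechet_derivative (D b) (at p) v) = \<beta>"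
  proof -
    have "(\<Sum>b\<in>Basis. (v \<bullet> b) * frechet_derivative (D b) (at p) v) = (\<Sum>b\<in>Basis. (v \<bullet> b) * frechet_derivative (D v) (at p) b)"
      unfolding D_def using p(1) by (intro sum.cong arg_cong2[of _ _ _ _ "(*)"] refl mixed_partials_commute[OF open_U _ Q(1)]) auto
    also have "\<dots> = frechet_derivative (D v) (at p) v"
      using frechet_derivative_Basis_sum[OF sD, of p v v] p(1) by simp
    finally have "(\<Sum>b\<in>Basis. (v \<bullet> b) * frechet_derivative (D b) (at p) v) = frechet_derivative (D v) (at p) v" .
    then show ?thesis by (simp add: \<beta>_def D_def [abs_def])
  qed
  finally have lim: "((\<lambda>t. \<Sum>b\<in>Basis. (\<gamma>' t \<bullet> b) * (D b (\<gamma> t) / t)) \<longlongrightarrow> \<beta>) (at 0)" .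
  assume "\<not> ?thesis"
  then have "\<beta> > 0" by (simp add: \<beta>_def)
  then have "\<forall>\<^sub>F t in at 0. (\<Sum>b\<in>Basis. (\<gamma>' t \<bullet> b) * (D b (\<gamma> t) / t)) > 0"
    using lim by (rule order_tendstoD(1)[rotated])
  then obtain r where r: "r > 0" "\<And>t. t \<noteq> 0 \<Longrightarrow> dist t 0 < r \<Longrightarrow> (\<Sum>b\<in>Basis. (\<gamma>' t \<bullet> b) * (D b (\<gamma> t) / t)) > 0"
    unfolding eventually_at by auto
  define s where "s = min \<epsilon> r / 2"
  have s: "s > 0" "s < \<epsilon>" "s < r" using \<gamma>(1) r(1) by (auto simp: s_def)
  have "\<exists>z. 0 < z \<and> z < s \<and> (Q \<circ> \<gamma>) s - (Q \<circ> \<gamma>) 0 = (s - 0) * (\<Sum>b\<in>Basis. (\<gamma>' z \<bullet> b) * D b (\<gamma> z))"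
    using s \<gamma>(1) by (intro MVT2 q') auto
  then obtain z where z: "0 < z" "z < s" "Q (\<gamma> s) = s * (\<Sum>b\<in>Basis. (\<gamma>' z \<bullet> b) * D b (\<gamma> z))"
    using \<gamma>(3) p by auto
  have "(\<Sum>b\<in>Basis. (\<gamma>' z \<bullet> b) * D b (\<gamma> z)) = z * (\<Sum>b\<in>Basis. (\<gamma>' z \<bullet> b) * (D b (\<gamma> z) / z))"
    using z by (simp add: sum_distrib_left)
  moreover have "(\<Sum>b\<in>Basis. (\<gamma>' z \<bullet> b) * (D b (\<gamma> z) / z)) > 0" using z s by (intro r) auto
  ultimately have "Q (\<gamma> s) > 0" using z s by simp
  moreover have "Q (\<gamma> s) \<le> 0" using s by (intro \<gamma>) auto
  ultimately show False by simp
qed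

text \<open>Subtracting a multiple of \<open>f\<close> from \<open>Q\<close> changes nothing on \<open>S\<close> and makes the touching point
  an ambient critical point.\<close>

lemma maximum_principle:
  assumes Q: "smooth_on U Q" "\<And>y. y \<in> S \<inter> U \<Longrightarrow> Q y \<le> (0::real)"
    and p: "p \<in> S \<inter> U" "Q p = 0"
  shows "d i Q p = 0" "(\<Sum>k\<in>Basis. d k (d k Q) p) \<le> 0"
proof -
  show "d i Q p = 0" unfolding d_def by (rule d_eq_0_at_max[OF Q p proj_tangent[OF p(1)]])
  define c where "c = frechet_derivative Q (at p) (N p) / frechet_derivative f (at p) (N p)"
  define P where "P = (\<lambda>y. Q y - c * f y)"
  have sP: "smooth_on U P" unfolding P_def by (intro smooth_intros open_U Q smooth_f)
  have PQ: "P y = Q y" if "y \<in> S \<inter> U" for y using f_eq_0[OF that] by (simp add: P_def)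
  have "(P has_derivative (\<lambda>w. frechet_derivative Q (at p) w - c * frechet_derivative f (at p) w)) (at p)"
    unfolding P_def using p(1)
    by (intro has_derivative_diff has_derivative_mult_right smooth_on_has_derivative[of U] Q smooth_f) auto
  then have DP: "frechet_derivative P (at p) w = frechet_derivative Q (at p) w - c * frechet_derivative f (at p) w" for w
    by (rule frechet_eqI)
  have crit: "frechet_derivative P (at p) w = 0" for w
  proof -
    have "frechet_derivative P (at p) (proj p w) = 0"
      using p Q sP PQ by (intro d_eq_0_at_max proj_tangent) auto
    moreover have "frechet_derivative P (at p) (N p) = 0"
      using f_deriv_N[OF p(1)] by (simp add: DP c_def)
    ultimately show ?thesis using d_eq[OF sP, of p w] p(1) by (simp add: d_def)
  qed
  have "d k (d k Q) p \<le> 0" for k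
  proof -
    have "d k (d k Q) p = d k (d k P) p"
      using p PQ by (intro d_cong smooth_intros Q sP) auto
    also have "\<dots> = frechet_derivative (\<lambda>y. frechet_derivative P (at y) (proj p k)) (at p) (proj p k)"
      by (simp add: dd_eq[OF sP p(1)] crit)
    also have "\<dots> \<le> 0"
      using p Q sP PQ crit by (intro hessian_nonpos_at_critical_max proj_tangent) auto
    finally show ?thesis .
  qed
  then show "(\<Sum>k\<in>Basis. d k (d k Q) p) \<le> 0" by (intro sum_nonpos)
qed

end

section \<open>Simons' identity\<close>

context hypersurface_patch
begin

text \<open>The sums here and in the next definitions run over the ambient basis. On
  \<open>S\<close> they equal the intrinsic contractions, since \<open>h\<close> vanishes there as
  soon as one argument is normal.\<close>

definition H :: "'a \<Rightarrow> real" where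
  "H x = (\<Sum>k\<in>Basis. h k k x)"

definition h2 :: "'a \<Rightarrow> 'a \<Rightarrow> 'a \<Rightarrow> real" where
  "h2 i j x = (\<Sum>l\<in>Basis. h i l x * h l j x)"

definition a :: "'a \<Rightarrow> real" where
  "a x = (\<Sum>i\<in>Basis. \<Sum>j\<in>Basis. (h i j x)\<^sup>2)"

definition tr3 :: "'a \<Rightarrow> real" where
  "tr3 x = (\<Sum>i\<in>Basis. \<Sum>j\<in>Basis. h i j x * h2 i j x)"

definition tr4 :: "'a \<Rightarrow> real" where
  "tr4 x = (\<Sum>i\<in>Basis. \<Sum>j\<in>Basis. (h2 i j x)\<^sup>2)"

lemma d_sum2:
  assumes "\<And>k l. smooth_on U (F k l)" "x \<in> U"
  shows "d i (\<lambda>y. \<Sum>k\<in>I. \<Sum>l\<in>J. F k l y) x = (\<Sum>k\<in>I. \<Sum>l\<in>J. d i (F k l) x)"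
  using assms by (simp add: d_sum smooth_on_sum open_U)

lemma smooth_H [smooth_intros]: "smooth_on U H"
  unfolding H_def by (intro smooth_intros open_U)

lemma smooth_h2 [smooth_intros]: "smooth_on U (h2 i j)"
  unfolding h2_def by (intro smooth_intros open_U)

lemma smooth_a [smooth_intros]: "smooth_on U a"
  unfolding a_def by (intro smooth_intros open_U)

lemma d_h_sym: "x \<in> S \<inter> U \<Longrightarrow> d k (h i j) x = d k (h j i) x"
  by (intro d_cong smooth_intros h_sym)

text \<open>Intrinsically the covariant derivative of \<open>h\<close> is symmetric; the
  \<open>h2\<close> terms appear because ambient components are differentiated, and each carries a
  factor \<open>n\<close>.\<close>

lemma codazzi:
  assumes "x \<in> S \<inter> U"
  shows "d k (h i j) x = d i (h k j) x + n k x * h2 i j x - n i x * h2 k j x"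
  using d_commutator[OF smooth_n assms, of k i j] by (simp add: h_def h2_def)

lemma n_h_left: "x \<in> S \<inter> U \<Longrightarrow> (\<Sum>i\<in>Basis. n i x * h i j x) = 0"
  using h_n[of x j] h_sym[of x] by simp

lemma n_h2:
  assumes x: "x \<in> S \<inter> U"
  shows "(\<Sum>k\<in>Basis. n k x * h2 j k x) = 0"
proof -
  have "(\<Sum>k\<in>Basis. n k x * h2 j k x) = (\<Sum>k\<in>Basis. \<Sum>l\<in>Basis. h j l x * (n k x * h l k x))"
    by (simp add: h2_def sum_distrib_left mult_ac)
  also have "\<dots> = (\<Sum>l\<in>Basis. h j l x * (\<Sum>k\<in>Basis. n k x * h l k x))"
    by (subst sum.swap) (simp add: sum_distrib_left)
  also have "\<dots> = 0" using h_n[OF x] by simp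
  finally show ?thesis .
qed

lemma trace_h2: "x \<in> S \<inter> U \<Longrightarrow> (\<Sum>k\<in>Basis. h2 k k x) = a x"
  unfolding h2_def a_def using h_sym[of x]
  by (intro sum.cong refl) (simp add: power2_eq_square)

text \<open>The trace of the Codazzi equation, after \<open>d_h_sym\<close> has brought the
  differentiated index next to the contracted one.\<close>

lemma divergence_h:
  assumes x: "x \<in> S \<inter> U"
  shows "(\<Sum>k\<in>Basis. d k (h k j) x) = d j H x - n j x * a x"
proof -
  have "(\<Sum>k\<in>Basis. d k (h k j) x) = (\<Sum>k\<in>Basis. d j (h k k) x + n k x * h2 j k x - n j x * h2 k k x)"
  proof (intro sum.cong refl)
    fix k
    show "d k (h k j) x = d j (h k k) x + n k x * h2 j k x - n j x * h2 k k x"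
      using codazzi[OF x, of k j k] d_h_sym[OF x, of k k j] by simp
  qed
  also have "\<dots> = (\<Sum>k\<in>Basis. d j (h k k) x) + (\<Sum>k\<in>Basis. n k x * h2 j k x) - n j x * (\<Sum>k\<in>Basis. h2 k k x)"
    by (simp add: sum.distrib sum_subtractf sum_distrib_left)
  also have "(\<Sum>k\<in>Basis. d j (h k k) x) = d j H x"
    unfolding H_def using x by (simp add: d_sum smooth_h)
  finally show ?thesis using n_h2[OF x] trace_h2[OF x] by simp
qed

text \<open>Differentiating \<open>h(N, j) = 0\<close> shows that the normal components of
  \<open>d k h\<close> are known algebraically.\<close>

lemma n_d_h:
  assumes x: "x \<in> S \<inter> U"
  shows "(\<Sum>i\<in>Basis. n i x * d k (h i j) x) = - h2 k j x"
proof -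
  have "d k (\<lambda>y. \<Sum>i\<in>Basis. n i y * h i j y) x = d k (\<lambda>y. 0) x"
    using x n_h_left by (intro d_cong smooth_intros open_U) auto
  moreover have "d k (\<lambda>y. \<Sum>i\<in>Basis. n i y * h i j y) x
      = (\<Sum>i\<in>Basis. h k i x * h i j x + n i x * d k (h i j) x)"
    using x by (subst d_sum) (auto intro!: smooth_intros open_U sum.cong simp: d_mult smooth_n smooth_h h_def[of k])
  ultimately show ?thesis by (simp add: sum.distrib h2_def)
qed

lemma d_a:
  assumes "x \<in> U"
  shows "d k a x = 2 * (\<Sum>i\<in>Basis. \<Sum>j\<in>Basis. h i j x * d k (h i j) x)"
proof -
  have "d k a x = (\<Sum>i\<in>Basis. \<Sum>j\<in>Basis. d k (\<lambda>y. (h i j y)\<^sup>2) x)"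
    unfolding a_def by (intro d_sum2 smooth_intros open_U assms)
  then show ?thesis
    using assms by (simp add: d_power2 smooth_h sum_distrib_left mult.assoc)
qed

text \<open>Together with the next lemma this discards every term with a free factor
  \<open>n i\<close> or \<open>n j\<close> once it is contracted with \<open>h\<close>, whatever the
  other factor is.\<close>

lemma contract_n_left:
  assumes x: "x \<in> S \<inter> U"
  shows "(\<Sum>i\<in>Basis. \<Sum>j\<in>Basis. h i j x * (n i x * X j)) = 0"
proof -
  have "(\<Sum>i\<in>Basis. \<Sum>j\<in>Basis. h i j x * (n i x * X j)) = (\<Sum>j\<in>Basis. (\<Sum>i\<in>Basis. n i x * h i j x) * X j)"
    by (subst sum.swap) (simp add: sum_distrib_left sum_distrib_right mult_ac)
  then show ?thesis using n_h_left[OF x] by simp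
qed

lemma contract_n_right:
  assumes x: "x \<in> S \<inter> U"
  shows "(\<Sum>i\<in>Basis. \<Sum>j\<in>Basis. h i j x * (n j x * X i)) = 0"
proof -
  have "(\<Sum>i\<in>Basis. \<Sum>j\<in>Basis. h i j x * (n j x * X i)) = (\<Sum>i\<in>Basis. (\<Sum>j\<in>Basis. n j x * h i j x) * X i)"
    by (simp add: sum_distrib_left sum_distrib_right mult_ac)
  then show ?thesis using h_n[OF x] by simp
qed

text \<open>Both sides are the trace of the fourth power of the shape operator; regrouping the
  factors in pairs gives squares of entries of \<open>h2\<close>.\<close>

lemma contract_h3:
  assumes x: "x \<in> S \<inter> U"
  shows "(\<Sum>i\<in>Basis. \<Sum>j\<in>Basis. h i j x * (\<Sum>l\<in>Basis. h i l x * h2 l j x)) = tr4 x"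
proof -
  have "(\<Sum>i\<in>Basis. \<Sum>j\<in>Basis. h i j x * (\<Sum>l\<in>Basis. h i l x * h2 l j x))
      = (\<Sum>i\<in>Basis. \<Sum>j\<in>Basis. \<Sum>l\<in>Basis. h l i x * h i j x * h2 l j x)"
    using h_sym[OF x] by (simp add: sum_distrib_left mult_ac)
  also have "\<dots> = (\<Sum>j\<in>Basis. \<Sum>i\<in>Basis. \<Sum>l\<in>Basis. h l i x * h i j x * h2 l j x)"
    by (rule sum.swap)
  also have "\<dots> = (\<Sum>j\<in>Basis. \<Sum>l\<in>Basis. \<Sum>i\<in>Basis. h l i x * h i j x * h2 l j x)"
    by (intro sum.cong refl sum.swap)
  also have "\<dots> = (\<Sum>l\<in>Basis. \<Sum>j\<in>Basis. \<Sum>i\<in>Basis. h l i x * h i j x * h2 l j x)"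
    by (rule sum.swap)
  also have "\<dots> = tr4 x"
    by (simp add: tr4_def h2_def power2_eq_square flip: sum_distrib_right)
  finally show ?thesis .
qed

text \<open>Simons' identity before contraction: Codazzi moves the inner derivative to index
  \<open>i\<close>, the commutator exchanges the two derivatives, and the divergence formula
  produces the Hessian of \<open>H\<close>. Terms with a factor \<open>n i\<close> or
  \<open>n j\<close> are kept together for later removal.\<close>

lemma laplacian_h:
  assumes x: "x \<in> S \<inter> U"
  shows "(\<Sum>k\<in>Basis. d k (d k (h i j)) x) = d i (d j H) x - a x * h i j x
    - 2 * (\<Sum>l\<in>Basis. h i l x * h2 l j x) + H x * h2 i j x - n j x * d i a x
    - n i x * (\<Sum>k\<in>Basis. (\<Sum>l\<in>Basis. h k l x * d l (h k j) x) + d k (h2 k j) x)"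
proof -
  have xU: "x \<in> U" using x by simp
  have dd: "d k (d k (h i j)) x = d i (d k (h k j)) x
      + n k x * (\<Sum>l\<in>Basis. h i l x * d l (h k j) x) - n i x * (\<Sum>l\<in>Basis. h k l x * d l (h k j) x)
      + h k k x * h2 i j x + n k x * d k (h2 i j) x - h k i x * h2 k j x - n i x * d k (h2 k j) x" for k
  proof -
    have "d k (d k (h i j)) x = d k (\<lambda>y. d i (h k j) y + n k y * h2 i j y - n i y * h2 k j y) x"
      by (intro d_cong smooth_intros open_U codazzi x)
    also have "\<dots> = d k (\<lambda>y. d i (h k j) y + n k y * h2 i j y) x - d k (\<lambda>y. n i y * h2 k j y) x"
      by (intro d_diff smooth_intros open_U xU)
    also have "d k (\<lambda>y. d i (h k j) y + n k y * h2 i j y) x = d k (d i (h k j)) x + d k (\<lambda>y. n k y * h2 i j y) x"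
      by (intro d_add smooth_intros open_U xU)
    also have "d k (\<lambda>y. n k y * h2 i j y) x = h k k x * h2 i j x + n k x * d k (h2 i j) x"
      unfolding h_def by (intro d_mult smooth_intros xU)
    also have "d k (\<lambda>y. n i y * h2 k j y) x = h k i x * h2 k j x + n i x * d k (h2 k j) x"
      unfolding h_def by (intro d_mult smooth_intros xU)
    finally show ?thesis
      using d_commutator[OF smooth_h x, of k i k j] by simp
  qed
  have 1: "(\<Sum>k\<in>Basis. d i (d k (h k j)) x) = d i (d j H) x - (h i j x * a x + n j x * d i a x)"
  proof -
    have "(\<Sum>k\<in>Basis. d i (d k (h k j)) x) = d i (\<lambda>y. \<Sum>k\<in>Basis. d k (h k j) y) x"
      using xU by (simp add: d_sum smooth_intros)
    also have "\<dots> = d i (\<lambda>y. d j H y - n j y * a y) x"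
      using x divergence_h by (intro d_cong smooth_intros open_U) auto
    also have "\<dots> = d i (d j H) x - d i (\<lambda>y. n j y * a y) x"
      by (intro d_diff smooth_intros open_U xU)
    also have "d i (\<lambda>y. n j y * a y) x = h i j x * a x + n j x * d i a x"
      unfolding h_def by (intro d_mult smooth_intros xU)
    finally show ?thesis .
  qed
  \<comment> \<open>This commutator term and the term in \<open>4\<close> coincide; together they
    account for the coefficient 2 of the cubic term.\<close>
  have 2: "(\<Sum>k\<in>Basis. n k x * (\<Sum>l\<in>Basis. h i l x * d l (h k j) x)) = - (\<Sum>l\<in>Basis. h i l x * h2 l j x)"
  proof -
    have "(\<Sum>k\<in>Basis. n k x * (\<Sum>l\<in>Basis. h i l x * d l (h k j) x)) =
        (\<Sum>l\<in>Basis. h i l x * (\<Sum>k\<in>Basis. n k x * d l (h k j) x))"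
      by (simp add: sum_distrib_left mult_ac) (rule sum.swap)
    then show ?thesis using n_d_h[OF x] by (simp add: sum_negf)
  qed
  have 3: "(\<Sum>k\<in>Basis. n k x * d k (h2 i j) x) = 0"
    by (rule normal_d[OF smooth_h2 x])
  have 4: "(\<Sum>k\<in>Basis. h k i x * h2 k j x) = (\<Sum>l\<in>Basis. h i l x * h2 l j x)"
    using h_sym[OF x] by simp
  have "(\<Sum>k\<in>Basis. d k (d k (h i j)) x) = (\<Sum>k\<in>Basis. d i (d k (h k j)) x)
      + (\<Sum>k\<in>Basis. n k x * (\<Sum>l\<in>Basis. h i l x * d l (h k j) x))
      - n i x * (\<Sum>k\<in>Basis. \<Sum>l\<in>Basis. h k l x * d l (h k j) x)
      + H x * h2 i j x + (\<Sum>k\<in>Basis. n k x * d k (h2 i j) x)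
      - (\<Sum>k\<in>Basis. h k i x * h2 k j x) - n i x * (\<Sum>k\<in>Basis. d k (h2 k j) x)"
    unfolding dd H_def sum.distrib sum_subtractf sum_distrib_left[symmetric] sum_distrib_right[symmetric] ..
  then show ?thesis
    unfolding 1 2 3 4 by (simp add: sum.distrib algebra_simps)
qed

lemma h_laplacian_h:
  assumes x: "x \<in> S \<inter> U"
  shows "(\<Sum>i\<in>Basis. \<Sum>j\<in>Basis. h i j x * (\<Sum>k\<in>Basis. d k (d k (h i j)) x)) =
    (\<Sum>i\<in>Basis. \<Sum>j\<in>Basis. h i j x * d i (d j H) x) - (a x)\<^sup>2 + H x * tr3 x - 2 * tr4 x"
proof -
  define q where "q i j = (\<Sum>l\<in>Basis. h i l x * h2 l j x)" for i j
  define X where "X j = (\<Sum>k\<in>Basis. (\<Sum>l\<in>Basis. h k l x * d l (h k j) x) + d k (h2 k j) x)" for j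
  have "h i j x * (\<Sum>k\<in>Basis. d k (d k (h i j)) x) = h i j x * d i (d j H) x - a x * (h i j x)\<^sup>2
      - 2 * (h i j x * q i j) + H x * (h i j x * h2 i j x) - h i j x * (n j x * d i a x)
      - h i j x * (n i x * X j)" for i j
    unfolding laplacian_h[OF x] q_def[symmetric] X_def[symmetric]
    by (simp add: algebra_simps power2_eq_square)
  then have "(\<Sum>i\<in>Basis. \<Sum>j\<in>Basis. h i j x * (\<Sum>k\<in>Basis. d k (d k (h i j)) x)) =
      (\<Sum>i\<in>Basis. \<Sum>j\<in>Basis. h i j x * d i (d j H) x) - a x * a x
      - 2 * (\<Sum>i\<in>Basis. \<Sum>j\<in>Basis. h i j x * q i j) + H x * tr3 x
      - (\<Sum>i\<in>Basis. \<Sum>j\<in>Basis. h i j x * (n j x * d i a x))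
      - (\<Sum>i\<in>Basis. \<Sum>j\<in>Basis. h i j x * (n i x * X j))"
    by (simp only: sum.distrib sum_subtractf sum_distrib_left[symmetric] a_def[symmetric] tr3_def[symmetric])
  then show ?thesis
    using contract_n_right[OF x, of "\<lambda>i. d i a x"] contract_n_left[OF x, of X] contract_h3[OF x]
    by (simp add: q_def power2_eq_square)
qed

text \<open>On \<open>S\<close> this is the intrinsic squared norm of \<nabla>A: by
  \<open>n_d_h\<close> the normal component in each of the two slots of \<open>h\<close> has squared
  norm \<open>tr4\<close>, and the component normal in both slots vanishes.\<close>

definition grad_h_sq :: "'a \<Rightarrow> real" where
  "grad_h_sq x = (\<Sum>k\<in>Basis. \<Sum>i\<in>Basis. \<Sum>j\<in>Basis. (d k (h i j) x)\<^sup>2) - 2 * tr4 x"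

text \<open>The term \<open>- 2 * tr4 x\<close> in \<open>h_laplacian_h\<close> is exactly what
  turns the full sum of squares of \<open>d k (h i j)\<close> into \<open>grad_h_sq\<close>.\<close>

lemma laplacian_a:
  assumes x: "x \<in> S \<inter> U"
  shows "(\<Sum>k\<in>Basis. d k (d k a) x) =
    2 * (\<Sum>i\<in>Basis. \<Sum>j\<in>Basis. h i j x * d i (d j H) x) - 2 * (a x)\<^sup>2 + 2 * H x * tr3 x + 2 * grad_h_sq x"
proof -
  have xU: "x \<in> U" using x by simp
  have "d k (d k a) x = 2 * (\<Sum>i\<in>Basis. \<Sum>j\<in>Basis. (d k (h i j) x)\<^sup>2 + h i j x * d k (d k (h i j)) x)" for k
  proof -
    have "d k (d k a) x = d k (\<lambda>y. 2 * (\<Sum>i\<in>Basis. \<Sum>j\<in>Basis. h i j y * d k (h i j) y)) x"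
      using x d_a by (intro d_cong smooth_intros open_U) auto
    also have "\<dots> = 2 * d k (\<lambda>y. \<Sum>i\<in>Basis. \<Sum>j\<in>Basis. h i j y * d k (h i j) y) x"
      by (intro d_cmult smooth_intros open_U xU)
    also have "d k (\<lambda>y. \<Sum>i\<in>Basis. \<Sum>j\<in>Basis. h i j y * d k (h i j) y) x
        = (\<Sum>i\<in>Basis. \<Sum>j\<in>Basis. d k (\<lambda>y. h i j y * d k (h i j) y) x)"
      by (intro d_sum2 smooth_intros open_U xU)
    finally show ?thesis
      using xU by (simp add: d_mult smooth_h smooth_d power2_eq_square)
  qed
  then have "(\<Sum>k\<in>Basis. d k (d k a) x) =
      2 * ((\<Sum>k\<in>Basis. \<Sum>i\<in>Basis. \<Sum>j\<in>Basis. (d k (h i j) x)\<^sup>2)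
         + (\<Sum>k\<in>Basis. \<Sum>i\<in>Basis. \<Sum>j\<in>Basis. h i j x * d k (d k (h i j)) x))"
    by (simp only: sum.distrib sum_distrib_left[symmetric])
  also have "(\<Sum>k\<in>Basis. \<Sum>i\<in>Basis. \<Sum>j\<in>Basis. h i j x * d k (d k (h i j)) x)
      = (\<Sum>i\<in>Basis. \<Sum>k\<in>Basis. \<Sum>j\<in>Basis. h i j x * d k (d k (h i j)) x)"
    by (rule sum.swap)
  also have "\<dots> = (\<Sum>i\<in>Basis. \<Sum>j\<in>Basis. \<Sum>k\<in>Basis. h i j x * d k (d k (h i j)) x)"
    by (intro sum.cong refl sum.swap)
  also have "\<dots> = (\<Sum>i\<in>Basis. \<Sum>j\<in>Basis. h i j x * (\<Sum>k\<in>Basis. d k (d k (h i j)) x))"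
    by (simp only: sum_distrib_left)
  finally show ?thesis
    unfolding h_laplacian_h[OF x] grad_h_sq_def by (simp add: algebra_simps)
qed

text \<open>\<open>T\<close> is the tangential part of \<open>d k h\<close>; the normal components of \<open>d k h\<close> account for \<open>tr4\<close>.\<close>

lemma kato:
  assumes x: "x \<in> S \<inter> U"
  shows "(\<Sum>k\<in>Basis. (d k a x)\<^sup>2) \<le> 4 * a x * grad_h_sq x"
proof -
  have xU: "x \<in> U" using x by simp
  have *: "(d k a x)\<^sup>2 \<le> 4 * a x * ((\<Sum>i\<in>Basis. \<Sum>j\<in>Basis. (d k (h i j) x)\<^sup>2) - 2 * (\<Sum>j\<in>Basis. (h2 k j x)\<^sup>2))" for k
  proof -
    define D where "D i j = d k (h i j) x" for i j
    define T where "T i j = D i j + n i x * h2 k j x + n j x * h2 k i x" for i j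
    have nD: "(\<Sum>i\<in>Basis. n i x * D i j) = - h2 k j x" for j
      using n_d_h[OF x] by (simp add: D_def)
    have Dsym: "D i j = D j i" for i j using d_h_sym[OF x] by (simp add: D_def)
    have "(\<Sum>i\<in>Basis. \<Sum>j\<in>Basis. h i j x * T i j) =
       (\<Sum>i\<in>Basis. \<Sum>j\<in>Basis. h i j x * D i j) + (\<Sum>i\<in>Basis. \<Sum>j\<in>Basis. h i j x * (n i x * h2 k j x))
        + (\<Sum>i\<in>Basis. \<Sum>j\<in>Basis. h i j x * (n j x * h2 k i x))"
      by (simp add: T_def distrib_left sum.distrib)
    then have da: "d k a x = 2 * (\<Sum>i\<in>Basis. \<Sum>j\<in>Basis. h i j x * T i j)"
      using contract_n_right[OF x] contract_n_left[OF x] d_a[OF xU] by (simp add: D_def)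
    have "(\<Sum>i\<in>Basis. \<Sum>j\<in>Basis. h i j x * T i j)\<^sup>2
        \<le> (\<Sum>i\<in>Basis. \<Sum>j\<in>Basis. (h i j x)\<^sup>2) * (\<Sum>i\<in>Basis. \<Sum>j\<in>Basis. (T i j)\<^sup>2)"
      unfolding sum.cartesian_product
      using Cauchy_Schwarz_ineq_sum[of "\<lambda>(i, j). h i j x" "\<lambda>(i, j). T i j" "Basis \<times> Basis"]
      by (simp add: case_prod_unfold)
    then have le: "(d k a x)\<^sup>2 \<le> 4 * (a x * (\<Sum>i\<in>Basis. \<Sum>j\<in>Basis. (T i j)\<^sup>2))"
      by (simp add: da a_def power_mult_distrib)
    define s where "s = (\<Sum>j\<in>Basis. (h2 k j x)\<^sup>2)"
    have e1: "(\<Sum>i\<in>Basis. \<Sum>j\<in>Basis. n i x * h2 k j x * D i j) = - s"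
    proof -
      have "(\<Sum>i\<in>Basis. \<Sum>j\<in>Basis. n i x * h2 k j x * D i j) = (\<Sum>j\<in>Basis. h2 k j x * (\<Sum>i\<in>Basis. n i x * D i j))"
        by (subst sum.swap) (simp add: sum_distrib_left mult_ac)
      then show ?thesis by (simp add: nD s_def power2_eq_square sum_negf)
    qed
    have e2: "(\<Sum>i\<in>Basis. \<Sum>j\<in>Basis. n j x * h2 k i x * D i j) = - s"
    proof -
      have "(\<Sum>i\<in>Basis. \<Sum>j\<in>Basis. n j x * h2 k i x * D i j) = (\<Sum>i\<in>Basis. \<Sum>j\<in>Basis. n j x * h2 k i x * D j i)"
        by (intro sum.cong refl arg_cong2[of _ _ _ _ "(*)"] Dsym)
      also have "\<dots> = (\<Sum>j\<in>Basis. \<Sum>i\<in>Basis. n j x * h2 k i x * D j i)" by (rule sum.swap)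
      also have "\<dots> = - s" by (rule e1)
      finally show ?thesis .
    qed
    have e3: "(\<Sum>i\<in>Basis. \<Sum>j\<in>Basis. (n i x * h2 k j x)\<^sup>2) = s"
    proof -
      have "(\<Sum>i\<in>Basis. \<Sum>j\<in>Basis. (n i x * h2 k j x)\<^sup>2) = (\<Sum>i\<in>Basis. n i x * n i x) * s"
        by (simp add: s_def sum_product power2_eq_square mult_ac)
      then show ?thesis using sum_n_square[OF x] by simp
    qed
    have e4: "(\<Sum>i\<in>Basis. \<Sum>j\<in>Basis. (n j x * h2 k i x)\<^sup>2) = s"
      using e3 by (subst sum.swap)
    \<comment> \<open>For each slot the mixed term contributes \<open>- 2 * s\<close> and the square
      \<open>s\<close>, so both slots remove \<open>2 * s\<close>. The last product sums to a
      multiple of the square of the contraction in \<open>n_h2\<close>, which is zero.\<close>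
    have "(T i j)\<^sup>2 = (D i j)\<^sup>2 + 2 * (n i x * h2 k j x * D i j) + 2 * (n j x * h2 k i x * D i j)
        + (n i x * h2 k j x)\<^sup>2 + (n j x * h2 k i x)\<^sup>2 + 2 * ((n i x * h2 k i x) * (n j x * h2 k j x))" for i j
      by (simp add: T_def power2_eq_square algebra_simps)
    then have "(\<Sum>i\<in>Basis. \<Sum>j\<in>Basis. (T i j)\<^sup>2) = (\<Sum>i\<in>Basis. \<Sum>j\<in>Basis. (D i j)\<^sup>2) + 2 * - s + 2 * - s + s + s + 2 * 0"
      by (simp only: sum.distrib sum_distrib_left[symmetric] e1 e2 e3 e4 n_h2[OF x] mult_zero_right sum.neutral_const)
    then have "(\<Sum>i\<in>Basis. \<Sum>j\<in>Basis. (T i j)\<^sup>2) = (\<Sum>i\<in>Basis. \<Sum>j\<in>Basis. (D i j)\<^sup>2) - 2 * s" by simp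
    then show ?thesis using le by (simp add: D_def s_def mult_ac)
  qed
  have "(\<Sum>k\<in>Basis. (d k a x)\<^sup>2) \<le> (\<Sum>k\<in>Basis. 4 * a x * ((\<Sum>i\<in>Basis. \<Sum>j\<in>Basis. (d k (h i j) x)\<^sup>2) - 2 * (\<Sum>j\<in>Basis. (h2 k j x)\<^sup>2)))"
    by (intro sum_mono *)
  also have "\<dots> = 4 * a x * grad_h_sq x"
    by (simp add: grad_h_sq_def tr4_def sum_subtractf flip: sum_distrib_left)
  finally show ?thesis .
qed

end

section \<open>Equations for the curvature of a shrinker\<close>

locale shrinker_patch = hypersurface_patch +
  assumes shrinker: "x \<in> S \<inter> U \<Longrightarrow> (\<Sum>k\<in>Basis. h k k x) = (x \<bullet> N x) / 2"
begin

lemma sum_x_n: "x \<in> S \<inter> U \<Longrightarrow> (\<Sum>l\<in>Basis. (x \<bullet> l) * n l x) = 2 * H x"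
  using shrinker[of x] by (simp add: H_def n_def euclidean_inner[of x "N x"])

text \<open>Differentiates \<open>x \<bullet> N = 2 H\<close>. The derivative of the position vector
  is the tangential projection, which contributes nothing when paired with \<open>N\<close>; only
  the derivative of \<open>N\<close> survives.\<close>

lemma d_H:
  assumes x: "x \<in> S \<inter> U"
  shows "d i H x = (\<Sum>l\<in>Basis. (x \<bullet> l) * h i l x) / 2"
proof -
  have xU: "x \<in> U" using x by simp
  have "d i H x = d i (\<lambda>y. (1/2) * (\<Sum>l\<in>Basis. (y \<bullet> l) * n l y)) x"
    using x sum_x_n by (intro d_cong smooth_intros open_U) auto
  also have "\<dots> = (1/2) * d i (\<lambda>y. \<Sum>l\<in>Basis. (y \<bullet> l) * n l y) x"
    by (intro d_cmult smooth_intros open_U xU)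
  also have "d i (\<lambda>y. \<Sum>l\<in>Basis. (y \<bullet> l) * n l y) x = (\<Sum>l\<in>Basis. (i \<bullet> l - n i x * n l x) * n l x + (x \<bullet> l) * h i l x)"
    using xU by (subst d_sum) (auto intro!: smooth_intros open_U sum.cong simp: d_mult smooth_n smooth_coord d_coord h_def)
  also have "\<dots> = (\<Sum>l\<in>Basis. (i \<bullet> l) * (N x \<bullet> l)) - n i x * (\<Sum>l\<in>Basis. n l x * n l x) + (\<Sum>l\<in>Basis. (x \<bullet> l) * h i l x)"
    by (simp add: sum.distrib sum_subtractf left_diff_distrib sum_distrib_left mult.assoc n_def)
  also have "\<dots> = (\<Sum>l\<in>Basis. (x \<bullet> l) * h i l x)"
    by (simp only: sum_n_square[OF x] euclidean_inner[symmetric]) (simp add: n_def inner_commute[of i])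
  finally show ?thesis by simp
qed

lemma dd_H:
  assumes x: "x \<in> S \<inter> U"
  shows "d i (d j H) x = (h j i x + (\<Sum>l\<in>Basis. (x \<bullet> l) * d i (h j l) x)) / 2"
proof -
  have xU: "x \<in> U" using x by simp
  have "d i (d j H) x = d i (\<lambda>y. (1/2) * (\<Sum>l\<in>Basis. (y \<bullet> l) * h j l y)) x"
    using x d_H by (intro d_cong smooth_intros open_U) auto
  also have "\<dots> = (1/2) * d i (\<lambda>y. \<Sum>l\<in>Basis. (y \<bullet> l) * h j l y) x"
    by (intro d_cmult smooth_intros open_U xU)
  also have "d i (\<lambda>y. \<Sum>l\<in>Basis. (y \<bullet> l) * h j l y) x = (\<Sum>l\<in>Basis. (i \<bullet> l - n i x * n l x) * h j l x + (x \<bullet> l) * d i (h j l) x)"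
    using xU by (subst d_sum) (auto intro!: smooth_intros open_U sum.cong simp: d_mult smooth_h smooth_coord d_coord)
  also have "\<dots> = (\<Sum>l\<in>Basis. (i \<bullet> l) * h j l x) - n i x * (\<Sum>l\<in>Basis. n l x * h j l x) + (\<Sum>l\<in>Basis. (x \<bullet> l) * d i (h j l) x)"
    by (simp add: sum.distrib sum_subtractf left_diff_distrib sum_distrib_left mult.assoc)
  also have "\<dots> = h j i x + (\<Sum>l\<in>Basis. (x \<bullet> l) * d i (h j l) x)"
    using h_n[OF x] h_linear[OF xU, of j i] by simp
  finally show ?thesis by simp
qed

text \<open>The divergence of \<open>h\<close> paired with the position vector gives the drift term,
  and its normal part gives the reaction term because \<open>x \<bullet> N = 2 H\<close>.\<close>

lemma laplacian_H:
  assumes x: "x \<in> S \<inter> U"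
  shows "(\<Sum>i\<in>Basis. d i (d i H) x) = H x / 2 + (\<Sum>l\<in>Basis. (x \<bullet> l) * d l H x) / 2 - H x * a x"
proof -
  have "(\<Sum>i\<in>Basis. d i (d i H) x) = (H x + (\<Sum>i\<in>Basis. \<Sum>l\<in>Basis. (x \<bullet> l) * d i (h i l) x)) / 2"
    by (simp add: dd_H[OF x] H_def sum.distrib add_divide_distrib sum_divide_distrib)
  also have "(\<Sum>i\<in>Basis. \<Sum>l\<in>Basis. (x \<bullet> l) * d i (h i l) x) = (\<Sum>l\<in>Basis. (x \<bullet> l) * (\<Sum>i\<in>Basis. d i (h i l) x))"
    by (subst sum.swap) (simp add: sum_distrib_left)
  also have "\<dots> = (\<Sum>l\<in>Basis. (x \<bullet> l) * d l H x) - (\<Sum>l\<in>Basis. (x \<bullet> l) * n l x) * a x"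
    by (simp add: divergence_h[OF x] right_diff_distrib sum_subtractf sum_distrib_right mult.assoc)
  finally show ?thesis by (simp add: sum_x_n[OF x] algebra_simps add_divide_distrib diff_divide_distrib)
qed

text \<open>Codazzi moves the derivative in \<open>dd_H\<close> onto the index \<open>l\<close>
  paired with the position vector, so contraction with \<open>h\<close> gives the drift of
  \<open>a\<close>. The normal part of the position vector yields the term with
  \<open>tr3\<close>.\<close>

lemma h_hessian_H:
  assumes x: "x \<in> S \<inter> U"
  shows "(\<Sum>i\<in>Basis. \<Sum>j\<in>Basis. h i j x * d i (d j H) x) =
    a x / 2 + (\<Sum>l\<in>Basis. (x \<bullet> l) * d l a x) / 4 - H x * tr3 x"
proof -
  have xU: "x \<in> U" using x by simp
  have "h i j x * (\<Sum>l\<in>Basis. (x \<bullet> l) * d i (h j l) x) = (\<Sum>l\<in>Basis. (x \<bullet> l) * (h i j x * d l (h i j) x))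
      + h i j x * (n i x * (\<Sum>l\<in>Basis. (x \<bullet> l) * h2 l j x)) - 2 * H x * (h i j x * h2 i j x)" for i j
  proof -
    have "d i (h j l) x = d l (h i j) x + n i x * h2 l j x - n l x * h2 i j x" for l
      using codazzi[OF x, of i l j] d_h_sym[OF x, of i j l] by simp
    then have "(\<Sum>l\<in>Basis. (x \<bullet> l) * d i (h j l) x) = (\<Sum>l\<in>Basis. (x \<bullet> l) * d l (h i j) x)
        + n i x * (\<Sum>l\<in>Basis. (x \<bullet> l) * h2 l j x) - (\<Sum>l\<in>Basis. (x \<bullet> l) * n l x) * h2 i j x"
      by (simp add: distrib_left right_diff_distrib sum.distrib sum_subtractf sum_distrib_left sum_distrib_right mult_ac)
    moreover have "p * (q + r - 2 * s * t) = p * q + p * r - 2 * s * (p * t)" for p q r s t :: real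
      by (simp add: algebra_simps)
    moreover have "(\<Sum>l\<in>Basis. (x \<bullet> l) * (h i j x * d l (h i j) x)) = h i j x * (\<Sum>l\<in>Basis. (x \<bullet> l) * d l (h i j) x)"
      by (simp add: sum_distrib_left mult_ac)
    ultimately show ?thesis unfolding sum_x_n[OF x] by simp
  qed
  then have "(\<Sum>i\<in>Basis. \<Sum>j\<in>Basis. h i j x * (\<Sum>l\<in>Basis. (x \<bullet> l) * d i (h j l) x)) =
      (\<Sum>i\<in>Basis. \<Sum>j\<in>Basis. \<Sum>l\<in>Basis. (x \<bullet> l) * (h i j x * d l (h i j) x))
      + (\<Sum>i\<in>Basis. \<Sum>j\<in>Basis. h i j x * (n i x * (\<Sum>l\<in>Basis. (x \<bullet> l) * h2 l j x))) - 2 * H x * tr3 x"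
    by (simp only: sum.distrib sum_subtractf sum_distrib_left[symmetric] tr3_def[symmetric])
  also have "(\<Sum>i\<in>Basis. \<Sum>j\<in>Basis. h i j x * (n i x * (\<Sum>l\<in>Basis. (x \<bullet> l) * h2 l j x))) = 0"
    by (rule contract_n_left[OF x])
  also have "(\<Sum>i\<in>Basis. \<Sum>j\<in>Basis. \<Sum>l\<in>Basis. (x \<bullet> l) * (h i j x * d l (h i j) x))
      = (\<Sum>i\<in>Basis. \<Sum>l\<in>Basis. \<Sum>j\<in>Basis. (x \<bullet> l) * (h i j x * d l (h i j) x))"
    by (intro sum.cong refl sum.swap)
  also have "\<dots> = (\<Sum>l\<in>Basis. \<Sum>i\<in>Basis. \<Sum>j\<in>Basis. (x \<bullet> l) * (h i j x * d l (h i j) x))"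
    by (rule sum.swap)
  also have "\<dots> = (\<Sum>l\<in>Basis. (x \<bullet> l) * d l a x) / 2"
    by (simp add: d_a[OF xU] sum_divide_distrib flip: sum_distrib_left)
  finally have 1: "(\<Sum>i\<in>Basis. \<Sum>j\<in>Basis. h i j x * (\<Sum>l\<in>Basis. (x \<bullet> l) * d i (h j l) x)) =
      (\<Sum>l\<in>Basis. (x \<bullet> l) * d l a x) / 2 - 2 * H x * tr3 x" by simp
  have "h i j x * d i (d j H) x = (1/2) * (h i j x)\<^sup>2 + (1/2) * (h i j x * (\<Sum>l\<in>Basis. (x \<bullet> l) * d i (h j l) x))" for i j
    unfolding dd_H[OF x] h_sym[OF x, of j i] by (simp add: power2_eq_square field_simps)
  then have "(\<Sum>i\<in>Basis. \<Sum>j\<in>Basis. h i j x * d i (d j H) x) = (1/2) * a x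
     + (1/2) * (\<Sum>i\<in>Basis. \<Sum>j\<in>Basis. h i j x * (\<Sum>l\<in>Basis. (x \<bullet> l) * d i (h j l) x))"
    by (simp only: sum.distrib sum_distrib_left[symmetric] a_def[symmetric])
  then show ?thesis unfolding 1 by simp
qed

text \<open>The two contributions \<open>2 * H x * tr3 x\<close> cancel, which is why no cubic term
  remains on a shrinker.\<close>

lemma simons:
  assumes x: "x \<in> S \<inter> U"
  shows "(\<Sum>k\<in>Basis. d k (d k a) x) =
    a x + (\<Sum>l\<in>Basis. (x \<bullet> l) * d l a x) / 2 - 2 * (a x)\<^sup>2 + 2 * grad_h_sq x"
  unfolding laplacian_a[OF x] h_hessian_H[OF x] by (simp add: field_simps)

lemma grad_H_le:
  assumes x: "x \<in> S \<inter> U"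
  shows "(\<Sum>k\<in>Basis. (d k H x)\<^sup>2) \<le> (x \<bullet> x) * a x / 4"
proof -
  have "(d k H x)\<^sup>2 \<le> (x \<bullet> x) * (\<Sum>l\<in>Basis. (h k l x)\<^sup>2) / 4" for k
  proof -
    have "(\<Sum>l\<in>Basis. (x \<bullet> l) * h k l x)\<^sup>2 \<le> (\<Sum>l\<in>Basis. (x \<bullet> l)\<^sup>2) * (\<Sum>l\<in>Basis. (h k l x)\<^sup>2)"
      by (rule Cauchy_Schwarz_ineq_sum)
    also have "(\<Sum>l\<in>Basis. (x \<bullet> l)\<^sup>2) = x \<bullet> x"
      by (simp add: power2_eq_square euclidean_inner[of x x])
    finally show ?thesis by (simp add: d_H[OF x] power_divide)
  qed
  then have "(\<Sum>k\<in>Basis. (d k H x)\<^sup>2) \<le> (\<Sum>k\<in>Basis. (x \<bullet> x) * (\<Sum>l\<in>Basis. (h k l x)\<^sup>2) / 4)"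
    by (intro sum_mono)
  then show ?thesis by (simp add: a_def sum_distrib_left sum_divide_distrib)
qed

end

section \<open>The estimate at a maximum point\<close>

text \<open>Pure algebra in which \<open>g\<close>, \<open>e\<close>, \<open>q\<close>,
  \<open>W\<close> stand for the gradients of |A|^2, of the cutoff and of \<open>H\<close>, and for
  |\<nabla>A|^2. The Kato inequality \<open>W\<close> bounds the good term below by the square of
  \<open>g\<close>, and \<open>crit\<close> eliminates \<open>g\<close>.\<close>

lemma critical_point_gradient_bound:
  fixes g e q :: "'b \<Rightarrow> real"
  assumes pos: "a > 0" "\<eta> > 0" "K > 0"
    and M: "M = a * \<eta>\<^sup>2 / K\<^sup>2"
    and crit: "\<And>k. k \<in> I \<Longrightarrow> g k * \<eta>\<^sup>2 + 2 * a * \<eta> * e k = 2 * M * K * q k"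
    and W: "(\<Sum>k\<in>I. (g k)\<^sup>2) \<le> 4 * a * W"
  shows "2 * \<eta>\<^sup>2 * W + 4 * \<eta> * (\<Sum>k\<in>I. g k * e k) + 2 * a * (\<Sum>k\<in>I. (e k)\<^sup>2) - 2 * M * (\<Sum>k\<in>I. (q k)\<^sup>2)
    \<ge> 4 * a * (\<Sum>k\<in>I. \<eta> / K * q k * e k) - 4 * a * (\<Sum>k\<in>I. (e k)\<^sup>2)"
proof -
  \<comment> \<open>With \<open>u = \<eta> / K * q k\<close> the critical equation reads
    \<open>\<eta> * g k = 2 * a * (u - e k)\<close>. The squares of \<open>u\<close> cancel, so
    everything left contains the cutoff gradient \<open>e\<close>.\<close>
  have *: "\<eta>\<^sup>2 / (2 * a) * (g k)\<^sup>2 + 4 * \<eta> * (g k * e k) + 2 * a * (e k)\<^sup>2 - 2 * M * (q k)\<^sup>2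
     = 4 * a * (\<eta> / K * q k * e k) - 4 * a * (e k)\<^sup>2" if "k \<in> I" for k
  proof -
    define u where "u = \<eta> / K * q k"
    have "\<eta> * (\<eta> * g k) = \<eta> * (2 * a * (u - e k))"
      using crit[OF that] pos unfolding M u_def by (simp add: power2_eq_square field_simps)
    then have g: "\<eta> * g k = 2 * a * (u - e k)" using pos by simp
    have "\<eta>\<^sup>2 / (2 * a) * (g k)\<^sup>2 = (\<eta> * g k)\<^sup>2 / (2 * a)" by (simp add: power_mult_distrib)
    also have "\<dots> = 2 * a * (u - e k)\<^sup>2" unfolding g using pos by (simp add: power2_eq_square)
    finally have 1: "\<eta>\<^sup>2 / (2 * a) * (g k)\<^sup>2 = 2 * a * (u - e k)\<^sup>2" .
    have 2: "4 * \<eta> * (g k * e k) = 8 * a * (u - e k) * e k" 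
    proof -
      have "4 * \<eta> * (g k * e k) = 4 * (\<eta> * g k) * e k" by simp
      then show ?thesis unfolding g by simp
    qed
    have 3: "2 * M * (q k)\<^sup>2 = 2 * a * u\<^sup>2" unfolding M u_def by (simp add: power_mult_distrib power_divide)
    show ?thesis unfolding 1 2 3 u_def[symmetric] by (simp add: power2_eq_square algebra_simps)
  qed
  have "\<eta>\<^sup>2 / (2 * a) * (\<Sum>k\<in>I. (g k)\<^sup>2) \<le> \<eta>\<^sup>2 / (2 * a) * (4 * a * W)"
    using W pos by (intro mult_left_mono) auto
  then have "\<eta>\<^sup>2 / (2 * a) * (\<Sum>k\<in>I. (g k)\<^sup>2) \<le> 2 * \<eta>\<^sup>2 * W" using pos by (simp add: mult_ac)
  moreover have "\<eta>\<^sup>2 / (2 * a) * (\<Sum>k\<in>I. (g k)\<^sup>2) + 4 * \<eta> * (\<Sum>k\<in>I. g k * e k) + 2 * a * (\<Sum>k\<in>I. (e k)\<^sup>2) - 2 * M * (\<Sum>k\<in>I. (q k)\<^sup>2)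
     = 4 * a * (\<Sum>k\<in>I. \<eta> / K * q k * e k) - 4 * a * (\<Sum>k\<in>I. (e k)\<^sup>2)"
    unfolding sum_distrib_left sum.distrib[symmetric] sum_subtractf[symmetric]
    using * by (intro sum.cong refl) (simp add: sum_distrib_left)
  ultimately show ?thesis by linarith
qed

text \<open>Completing the square bounds the term with \<open>sqrt M\<close> by
  \<open>c\<^sup>2 * M\<close> and a multiple of \<open>R ^ 4\<close>; half of the left side absorbs
  the former.\<close>

lemma quadratic_bound:
  fixes M R D c :: real
  assumes "c > 0" "M \<ge> 0" and le: "2 * M * c\<^sup>2 \<le> D * R ^ 4 + 4 * sqrt M * R\<^sup>2"
  shows "M \<le> (D + 4 / c\<^sup>2) / c\<^sup>2 * R ^ 4"
proof -
  have "0 \<le> (c * sqrt M - 2 * R\<^sup>2 / c)\<^sup>2" by simp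
  also have "\<dots> = c\<^sup>2 * M + 4 / c\<^sup>2 * R ^ 4 - 4 * sqrt M * R\<^sup>2"
    using assms(1,2) by (simp add: power2_diff power_mult_distrib power_divide field_simps) (simp add: power2_eq_square)
  finally have "M * c\<^sup>2 \<le> (D + 4 / c\<^sup>2) * R ^ 4" using le by (simp add: algebra_simps)
  then show ?thesis using assms(1) by (simp add: field_simps)
qed

context shrinker_patch
begin

text \<open>The gradient of the cutoff is minus twice the tangential part of the position vector,
  whose normal component is \<open>2 * H x\<close> on a shrinker.\<close>

lemma d_sq_norm:
  assumes x: "x \<in> S \<inter> U"
  shows "d k (\<lambda>y. r - y \<bullet> y) x = - 2 * (k \<bullet> x - 2 * H x * n k x)"
proof -
  have xU: "x \<in> U" using x by simp
  have "((\<lambda>y. r - y \<bullet> y) has_derivative (\<lambda>v. - (x \<bullet> v + v \<bullet> x))) (at x)"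
    by (auto intro!: derivative_eq_intros)
  moreover have "x \<bullet> N x = 2 * H x" using shrinker[OF x] by (simp add: H_def)
  ultimately show ?thesis
    by (simp add: d_def frechet_eqI proj_def inner_diff_left inner_diff_right inner_commute n_def)
qed

lemma laplacian_sq_norm:
  assumes x: "x \<in> S \<inter> U"
  shows "(\<Sum>k\<in>Basis. d k (d k (\<lambda>y. r - y \<bullet> y)) x) = 4 * (H x)\<^sup>2 - 2 * (real DIM('a) - 1)"
proof -
  have xU: "x \<in> U" using x by simp
  have s: "smooth_on U (\<lambda>y. r - y \<bullet> y)" by (intro smooth_intros open_U smooth_on_ident)
  have "d k (d k (\<lambda>y. r - y \<bullet> y)) x = - 2 * (k \<bullet> k - n k x * n k x) + 4 * (n k x * d k H x) + 4 * (H x * h k k x)" for k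
  proof -
    have "d k (d k (\<lambda>y. r - y \<bullet> y)) x = d k (\<lambda>y. - 2 * (y \<bullet> k - 2 * (H y * n k y))) x"
      using x by (intro d_cong smooth_intros open_U s) (auto simp: d_sq_norm inner_commute)
    also have "\<dots> = - 2 * d k (\<lambda>y. y \<bullet> k - 2 * (H y * n k y)) x"
      by (intro d_cmult smooth_intros open_U xU)
    also have "d k (\<lambda>y. y \<bullet> k - 2 * (H y * n k y)) x = d k (\<lambda>y. y \<bullet> k) x - d k (\<lambda>y. 2 * (H y * n k y)) x"
      by (intro d_diff smooth_intros open_U xU)
    also have "d k (\<lambda>y. 2 * (H y * n k y)) x = 2 * d k (\<lambda>y. H y * n k y) x"
      by (intro d_cmult smooth_intros open_U xU)
    also have "d k (\<lambda>y. H y * n k y) x = d k H x * n k x + H x * h k k x"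
      unfolding h_def by (intro d_mult smooth_intros xU)
    finally show ?thesis by (simp add: d_coord algebra_simps)
  qed
  then have "(\<Sum>k\<in>Basis. d k (d k (\<lambda>y. r - y \<bullet> y)) x) = - 2 * ((\<Sum>k\<in>Basis. (k::'a) \<bullet> k) - (\<Sum>k\<in>Basis. n k x * n k x))
      + 4 * (\<Sum>k\<in>Basis. n k x * d k H x) + 4 * (H x * H x)"
    by (simp only: H_def sum.distrib sum_subtractf sum_distrib_left[symmetric])
  then show ?thesis
    by (simp add: sum_n_square[OF x] normal_d[OF smooth_H x] power2_eq_square algebra_simps)
qed

text \<open>With \<open>M\<close> the maximum of the weighted quotient this test function is
  nonpositive and vanishes at the maximum point. Unlike the quotient it needs only product
  rules.\<close>

lemma d_test:
  assumes x: "x \<in> U" and G: "smooth_on U G"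
  shows "d k (\<lambda>y. a y * (G y)\<^sup>2 - M * (H y - c)\<^sup>2) x =
    d k a x * (G x)\<^sup>2 + 2 * a x * (G x * d k G x) - 2 * M * ((H x - c) * d k H x)"
proof -
  have K: "smooth_on U (\<lambda>y. H y - c)" by (intro smooth_intros open_U)
  have "d k (\<lambda>y. a y * (G y)\<^sup>2 - M * (H y - c)\<^sup>2) x = d k (\<lambda>y. a y * (G y)\<^sup>2) x - d k (\<lambda>y. M * (H y - c)\<^sup>2) x"
    by (intro d_diff smooth_intros open_U x G)
  also have "d k (\<lambda>y. a y * (G y)\<^sup>2) x = d k a x * (G x)\<^sup>2 + a x * d k (\<lambda>y. (G y)\<^sup>2) x"
    by (intro d_mult smooth_intros open_U x G)
  also have "d k (\<lambda>y. M * (H y - c)\<^sup>2) x = M * d k (\<lambda>y. (H y - c)\<^sup>2) x"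
    by (intro d_cmult smooth_intros open_U x)
  also have "d k (\<lambda>y. (H y - c)\<^sup>2) x = 2 * (H x - c) * d k (\<lambda>y. H y - c) x"
    by (intro d_power2 K x)
  also have "d k (\<lambda>y. H y - c) x = d k H x"
    using d_diff[OF smooth_H smooth_on_const x] by simp
  also have "d k (\<lambda>y. (G y)\<^sup>2) x = 2 * G x * d k G x"
    by (intro d_power2 G x)
  finally show ?thesis by (simp add: algebra_simps)
qed

lemma dd_test:
  assumes x: "x \<in> S \<inter> U" and G: "smooth_on U G"
  shows "d k (d k (\<lambda>y. a y * (G y)\<^sup>2 - M * (H y - c)\<^sup>2)) x =
    (G x)\<^sup>2 * d k (d k a) x + 4 * G x * (d k a x * d k G x) + 2 * a x * (d k G x)\<^sup>2
     + 2 * a x * G x * d k (d k G) x - 2 * M * (d k H x)\<^sup>2 - 2 * M * (H x - c) * d k (d k H) x"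
proof -
  have xU: "x \<in> U" using x by simp
  have K: "smooth_on U (\<lambda>y. H y - c)" by (intro smooth_intros open_U)
  have "d k (d k (\<lambda>y. a y * (G y)\<^sup>2 - M * (H y - c)\<^sup>2)) x =
     d k (\<lambda>y. d k a y * (G y)\<^sup>2 + 2 * (a y * (G y * d k G y)) - 2 * M * ((H y - c) * d k H y)) x"
    using x by (intro d_cong smooth_intros open_U G) (auto simp: d_test G)
  also have "\<dots> = d k (\<lambda>y. d k a y * (G y)\<^sup>2 + 2 * (a y * (G y * d k G y))) x - d k (\<lambda>y. 2 * M * ((H y - c) * d k H y)) x"
    by (intro d_diff smooth_intros open_U G xU)
  also have "d k (\<lambda>y. d k a y * (G y)\<^sup>2 + 2 * (a y * (G y * d k G y))) x = d k (\<lambda>y. d k a y * (G y)\<^sup>2) x + d k (\<lambda>y. 2 * (a y * (G y * d k G y))) x"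
    by (intro d_add smooth_intros open_U G xU)
  also have "d k (\<lambda>y. d k a y * (G y)\<^sup>2) x = d k (d k a) x * (G x)\<^sup>2 + d k a x * d k (\<lambda>y. (G y)\<^sup>2) x"
    by (intro d_mult smooth_intros open_U xU G)
  also have "d k (\<lambda>y. (G y)\<^sup>2) x = 2 * G x * d k G x"
    by (intro d_power2 G xU)
  also have "d k (\<lambda>y. 2 * (a y * (G y * d k G y))) x = 2 * d k (\<lambda>y. a y * (G y * d k G y)) x"
    by (intro d_cmult smooth_intros open_U xU G)
  also have "d k (\<lambda>y. a y * (G y * d k G y)) x = d k a x * (G x * d k G x) + a x * d k (\<lambda>y. G y * d k G y) x"
    by (intro d_mult smooth_intros open_U xU G)
  also have "d k (\<lambda>y. G y * d k G y) x = d k G x * d k G x + G x * d k (d k G) x"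
    by (intro d_mult smooth_intros open_U xU G)
  also have "d k (\<lambda>y. 2 * M * ((H y - c) * d k H y)) x = 2 * M * d k (\<lambda>y. (H y - c) * d k H y) x"
    by (intro d_cmult smooth_intros open_U xU)
  also have "d k (\<lambda>y. (H y - c) * d k H y) x = d k (\<lambda>y. H y - c) x * d k H x + (H x - c) * d k (d k H) x"
    by (intro d_mult smooth_intros open_U xU)
  also have "d k (\<lambda>y. H y - c) x = d k H x"
    using d_diff[OF smooth_H smooth_on_const xU] by simp
  finally show ?thesis by (simp add: algebra_simps power2_eq_square)
qed

lemma max_point_bound:
  assumes p: "p \<in> S \<inter> U" and c: "c > 0" "H p - c \<ge> c" and R: "R \<ge> 1" "p \<bullet> p < R\<^sup>2"
    and M: "M = a p * (R\<^sup>2 - p \<bullet> p)\<^sup>2 / (H p - c)\<^sup>2"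
    and max: "\<And>y. y \<in> S \<inter> U \<Longrightarrow> a y * (R\<^sup>2 - y \<bullet> y)\<^sup>2 \<le> M * (H y - c)\<^sup>2"
  shows "M \<le> (4 * real DIM('a) + 17 + 4 / c\<^sup>2) / c\<^sup>2 * R ^ 4"
\<comment> \<open>If \<open>a p = 0\<close> then \<open>M = 0\<close>; otherwise the inequality at
  the maximum can be divided by \<open>a p\<close>.\<close>
proof (cases "a p = 0")
  case True
  then show ?thesis using M by simp
next
  case False
  have "a p \<ge> 0" unfolding a_def by (intro sum_nonneg) simp
  then have a: "a p > 0" using False by simp
  have pU: "p \<in> U" using p by simp
  define G where "G = (\<lambda>y::'a. R\<^sup>2 - y \<bullet> y)"
  define Q where "Q = (\<lambda>y. a y * (G y)\<^sup>2 - M * (H y - c)\<^sup>2)"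
  define K where "K = H p - c"
  define \<eta> where "\<eta> = G p"
  have K: "K > 0" "K \<ge> c" using c by (auto simp: K_def)
  have \<eta>: "\<eta> > 0" "\<eta> \<le> R\<^sup>2" using R by (auto simp: \<eta>_def G_def)
  have M': "M = a p * \<eta>\<^sup>2 / K\<^sup>2" using M by (simp add: \<eta>_def K_def G_def)
  have M0: "M \<ge> 0" using a M' by simp
  have sG: "smooth_on U G" unfolding G_def by (intro smooth_intros open_U smooth_on_ident)
  have sQ: "smooth_on U Q" unfolding Q_def by (intro smooth_intros open_U sG)
  have Q: "Q y \<le> 0" if "y \<in> S \<inter> U" for y using max[OF that] by (simp add: Q_def G_def)
  have Qp: "Q p = 0" using K unfolding Q_def K_def[symmetric] \<eta>_def[symmetric] M' by simp
  define g e q where "g = (\<lambda>k. d k a p)" and "e = (\<lambda>k. d k G p)" and "q = (\<lambda>k. d k H p)"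
  have crit: "g k * \<eta>\<^sup>2 + 2 * a p * \<eta> * e k = 2 * M * K * q k" for k
    using maximum_principle(1)[OF sQ Q p Qp, of k]
    unfolding Q_def d_test[OF pU sG] by (simp add: \<eta>_def K_def g_def e_def q_def)
  have HN: "p \<bullet> N p = 2 * H p" using shrinker[OF p] by (simp add: H_def)
  have e: "e k = - 2 * (k \<bullet> p - 2 * H p * n k p)" for k
    unfolding e_def G_def by (rule d_sq_norm[OF p])
  have xx: "(\<Sum>k\<in>Basis. (p \<bullet> k) * (p \<bullet> k)) = p \<bullet> p" by (rule euclidean_inner[symmetric])
  have xe: "(\<Sum>k\<in>Basis. (p \<bullet> k) * e k) = - 2 * (p \<bullet> p - 4 * (H p)\<^sup>2)"
  proof -
    have "(\<Sum>k\<in>Basis. (p \<bullet> k) * e k) = - 2 * ((\<Sum>k\<in>Basis. (p \<bullet> k) * (p \<bullet> k)) - 2 * H p * (\<Sum>k\<in>Basis. (p \<bullet> k) * n k p))"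
      by (simp add: e inner_commute sum_distrib_left sum_subtractf[symmetric] algebra_simps)
    then show ?thesis unfolding xx sum_x_n[OF p] by (simp add: power2_eq_square)
  qed
  have ee: "(\<Sum>k\<in>Basis. (e k)\<^sup>2) = 4 * (p \<bullet> p - 4 * (H p)\<^sup>2)"
  proof -
    have "(\<Sum>k\<in>Basis. (e k)\<^sup>2) = 4 * ((\<Sum>k\<in>Basis. (p \<bullet> k) * (p \<bullet> k)) - 4 * H p * (\<Sum>k\<in>Basis. (p \<bullet> k) * n k p)
        + 4 * (H p)\<^sup>2 * (\<Sum>k\<in>Basis. n k p * n k p))"
      by (simp add: e inner_commute sum_distrib_left sum_subtractf[symmetric] sum.distrib[symmetric] algebra_simps power2_eq_square)
    then show ?thesis unfolding xx sum_x_n[OF p] sum_n_square[OF p] by (simp add: power2_eq_square)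
  qed
  define W where "W = grad_h_sq p"
  define D where "D = real DIM('a)"
  define Gx Hx where "Gx = (\<Sum>k\<in>Basis. (p \<bullet> k) * g k)" and "Hx = (\<Sum>k\<in>Basis. (p \<bullet> k) * q k)"
  have lap: "0 \<ge> \<eta>\<^sup>2 * (a p + Gx / 2 - 2 * (a p)\<^sup>2 + 2 * W) + 4 * \<eta> * (\<Sum>k\<in>Basis. g k * e k)
     + 2 * a p * (\<Sum>k\<in>Basis. (e k)\<^sup>2) + 2 * a p * \<eta> * (4 * (H p)\<^sup>2 - 2 * (D - 1))
     - 2 * M * (\<Sum>k\<in>Basis. (q k)\<^sup>2) - 2 * M * K * (H p / 2 + Hx / 2 - H p * a p)"
  proof -
    have "0 \<ge> (\<Sum>k\<in>Basis. d k (d k Q) p)" by (rule maximum_principle(2)[OF sQ Q p Qp])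
    also have "(\<Sum>k\<in>Basis. d k (d k Q) p) = \<eta>\<^sup>2 * (\<Sum>k\<in>Basis. d k (d k a) p) + 4 * \<eta> * (\<Sum>k\<in>Basis. g k * e k)
     + 2 * a p * (\<Sum>k\<in>Basis. (e k)\<^sup>2) + 2 * a p * \<eta> * (\<Sum>k\<in>Basis. d k (d k G) p)
     - 2 * M * (\<Sum>k\<in>Basis. (q k)\<^sup>2) - 2 * M * K * (\<Sum>k\<in>Basis. d k (d k H) p)"
      unfolding Q_def dd_test[OF p sG] g_def e_def q_def \<eta>_def K_def
      by (simp only: sum.distrib sum_subtractf sum_distrib_left)
    finally show ?thesis
      unfolding G_def laplacian_sq_norm[OF p] laplacian_H[OF p] simons[OF p]
      by (simp add: Gx_def Hx_def g_def q_def W_def D_def)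
  qed
  \<comment> \<open>Pairing the critical equation with the position vector removes both drift terms
    from \<open>lap\<close>; the squares of \<open>H p\<close> cancel against those in the Laplacian
    of the cutoff.\<close>
  have "(\<Sum>k\<in>Basis. (p \<bullet> k) * (g k * \<eta>\<^sup>2 + 2 * a p * \<eta> * e k)) = (\<Sum>k\<in>Basis. (p \<bullet> k) * (2 * M * K * q k))"
    by (simp only: crit)
  then have x: "\<eta>\<^sup>2 * Gx + 2 * a p * \<eta> * (- 2 * (p \<bullet> p - 4 * (H p)\<^sup>2)) = 2 * M * K * Hx"
    unfolding xe[symmetric] Gx_def Hx_def by (simp add: sum_distrib_left sum.distrib algebra_simps)
  have grad: "2 * \<eta>\<^sup>2 * W + 4 * \<eta> * (\<Sum>k\<in>Basis. g k * e k) + 2 * a p * (\<Sum>k\<in>Basis. (e k)\<^sup>2) - 2 * M * (\<Sum>k\<in>Basis. (q k)\<^sup>2)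
    \<ge> 4 * a p * (\<Sum>k\<in>Basis. \<eta> / K * q k * e k) - 4 * a p * (\<Sum>k\<in>Basis. (e k)\<^sup>2)"
    using kato[OF p] by (intro critical_point_gradient_bound a \<eta> K M' crit) (simp add: g_def W_def)
  define Y where "Y = (\<Sum>k\<in>Basis. \<eta> / K * q k * e k)"
  \<comment> \<open>Here \<open>H p / K = 1 + c / K\<close>. The 1 cancels the reaction terms of
    |A|^2, and \<open>c / K\<close> is the gain from subtracting \<open>c\<close>.\<close>
  have MK: "2 * M * K * (H p / 2 - H p * a p) = a p * (\<eta>\<^sup>2 * (1 - 2 * a p) * (1 + c / K))"
  proof -
    have "H p = K + c" by (simp add: K_def)
    then show ?thesis using K(1) unfolding M' by (simp add: power2_eq_square field_simps)
  qed
  have "a p * (\<eta>\<^sup>2 * (1 - 2 * a p)) + a p * (\<eta> * (2 * (p \<bullet> p) - 4 * (D - 1)))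
      + 4 * a p * Y - 4 * a p * (\<Sum>k\<in>Basis. (e k)\<^sup>2) - a p * (\<eta>\<^sup>2 * (1 - 2 * a p) * (1 + c / K)) \<le> 0"
    using lap grad x unfolding MK[symmetric] Y_def[symmetric]
    by (simp add: algebra_simps power2_eq_square)
  then have "a p * (\<eta>\<^sup>2 * (1 - 2 * a p) + \<eta> * (2 * (p \<bullet> p) - 4 * (D - 1)) + 4 * Y - 4 * (\<Sum>k\<in>Basis. (e k)\<^sup>2)
      - \<eta>\<^sup>2 * (1 - 2 * a p) * (1 + c / K)) \<le> 0"
    by (simp add: algebra_simps)
  then have "\<eta>\<^sup>2 * (1 - 2 * a p) + \<eta> * (2 * (p \<bullet> p) - 4 * (D - 1)) + 4 * Y - 4 * (\<Sum>k\<in>Basis. (e k)\<^sup>2)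
      - \<eta>\<^sup>2 * (1 - 2 * a p) * (1 + c / K) \<le> 0"
    using a by (simp add: mult_le_0_iff)
  moreover have "2 * M * (c * K) = 2 * a p * \<eta>\<^sup>2 * c / K" using K unfolding M' by (simp add: power2_eq_square)
  \<comment> \<open>The good term is linear in \<open>M\<close>, whereas the only term on the right
    that grows with \<open>M\<close>, namely \<open>Y\<close>, is of order
    \<open>sqrt M\<close>.\<close>
  ultimately have main: "2 * M * (c * K) \<le> \<eta>\<^sup>2 * (c / K) - \<eta> * (2 * (p \<bullet> p) - 4 * (D - 1)) - 4 * Y + 4 * (\<Sum>k\<in>Basis. (e k)\<^sup>2)"
    by (simp add: algebra_simps)
  have 1: "\<eta>\<^sup>2 * (c / K) \<le> R ^ 4"
  proof -
    have "\<eta>\<^sup>2 \<le> (R\<^sup>2)\<^sup>2" using \<eta> by (intro power_mono) auto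
    then have "\<eta>\<^sup>2 * (c / K) \<le> (R\<^sup>2)\<^sup>2 * 1" using K c by (intro mult_mono) auto
    then show ?thesis by simp
  qed
  have 2: "- \<eta> * (2 * (p \<bullet> p) - 4 * (D - 1)) \<le> 4 * D * R ^ 4"
  proof -
    have "- \<eta> * (2 * (p \<bullet> p) - 4 * (D - 1)) \<le> \<eta> * (4 * D)"
      using \<eta> mult_nonneg_nonneg[of \<eta> "2 * (p \<bullet> p) + 4"] by (simp add: algebra_simps)
    also have "\<dots> \<le> R ^ 4 * (4 * D)"
      using \<eta> R power_increasing[of 2 4 R] by (intro mult_right_mono) (auto simp: D_def)
    finally show ?thesis by (simp add: mult_ac)
  qed
  have e_le: "(\<Sum>k\<in>Basis. (e k)\<^sup>2) \<le> 4 * R\<^sup>2"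
    unfolding ee using R by (smt (verit) zero_le_power2)
  \<comment> \<open>By Cauchy-Schwarz, using that the squared gradient of \<open>H\<close> is at
    most \<open>R\<^sup>2 * a p / 4\<close> and that of the cutoff at most
    \<open>4 * R\<^sup>2\<close>; the remaining factor \<open>a p * (\<eta> / K)\<^sup>2\<close> is
    \<open>M\<close>.\<close>
  have 3: "- Y \<le> sqrt M * R\<^sup>2"
  proof -
    have "Y\<^sup>2 \<le> (\<Sum>k\<in>Basis. (\<eta> / K * q k)\<^sup>2) * (\<Sum>k\<in>Basis. (e k)\<^sup>2)"
      unfolding Y_def by (rule Cauchy_Schwarz_ineq_sum)
    also have "(\<Sum>k\<in>Basis. (\<eta> / K * q k)\<^sup>2) = (\<eta> / K)\<^sup>2 * (\<Sum>k\<in>Basis. (q k)\<^sup>2)"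
      by (simp only: power_mult_distrib sum_distrib_left)
    also have "(\<eta> / K)\<^sup>2 * (\<Sum>k\<in>Basis. (q k)\<^sup>2) * (\<Sum>k\<in>Basis. (e k)\<^sup>2) \<le> (\<eta> / K)\<^sup>2 * (R\<^sup>2 * a p / 4) * (4 * R\<^sup>2)"
    proof -
      have "(\<Sum>k\<in>Basis. (q k)\<^sup>2) \<le> R\<^sup>2 * a p / 4"
      proof -
        have "(p \<bullet> p) * a p \<le> R\<^sup>2 * a p" using R a by (intro mult_right_mono) auto
        then show ?thesis using grad_H_le[OF p] unfolding q_def by linarith
      qed
      then show ?thesis using e_le a by (intro mult_mono mult_left_mono) (auto intro!: sum_nonneg)
    qed
    also have "\<dots> = (sqrt M * R\<^sup>2)\<^sup>2"
      using M0 by (simp add: power_mult_distrib) (simp add: M' power_divide power2_eq_square power4_eq_xxxx)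
    finally have "\<bar>Y\<bar> \<le> sqrt M * R\<^sup>2" using M0 by (simp add: power2_le_iff_abs_le)
    then show ?thesis by simp
  qed
  have "2 * M * (c * K) \<le> R ^ 4 + 4 * D * R ^ 4 + 4 * (sqrt M * R\<^sup>2) + 4 * (4 * R\<^sup>2)"
    using main 1 2 3 e_le by linarith
  moreover have "2 * M * c\<^sup>2 \<le> 2 * M * (c * K)"
    using M0 K c by (intro mult_left_mono) (auto simp: power2_eq_square)
  moreover have "R\<^sup>2 \<le> R ^ 4" using R by (intro power_increasing) auto
  \<comment> \<open>17 is 1 from the first error term plus 16 from the cutoff gradient.\<close>
  ultimately have "2 * M * c\<^sup>2 \<le> (4 * D + 17) * R ^ 4 + 4 * sqrt M * R\<^sup>2"
    by (simp add: algebra_simps)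
  then show ?thesis using quadratic_bound[OF c(1) M0, of "4 * D + 17" R] by (simp add: D_def)
qed

end

section \<open>Charts, frames and the curvature estimate\<close>

lemma chart_derivatives:
  fixes \<phi> \<psi> :: "'a::euclidean_space \<Rightarrow> 'a"
  assumes U: "open U" "open V" "homeomorphism U V \<phi> \<psi>" "smooth_on U \<phi>" "smooth_on V \<psi>"
    and x: "x \<in> U"
  shows "frechet_derivative \<psi> (at (\<phi> x)) (frechet_derivative \<phi> (at x) v) = v"
    "frechet_derivative \<phi> (at x) (frechet_derivative \<psi> (at (\<phi> x)) w) = w"
proof -
  have inv: "\<psi> (\<phi> z) = z" if "z \<in> U" for z using U(3) that by (simp add: homeomorphism_def)
  have inv': "\<phi> (\<psi> z) = z" if "z \<in> V" for z using U(3) that by (simp add: homeomorphism_def)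
  have V: "\<phi> x \<in> V" using U(3) x by (auto simp: homeomorphism_def)
  have d\<phi>: "(\<phi> has_derivative frechet_derivative \<phi> (at x)) (at x)"
    by (rule smooth_on_has_derivative[OF U(4) x])
  have d\<psi>: "(\<psi> has_derivative frechet_derivative \<psi> (at (\<phi> x))) (at (\<phi> x))"
    by (rule smooth_on_has_derivative[OF U(5) V])
  have "((\<lambda>z. z) has_derivative frechet_derivative \<psi> (at (\<phi> x)) \<circ> frechet_derivative \<phi> (at x)) (at x)"
    by (rule has_derivative_transform_within_open[OF diff_chain_at[OF d\<phi> d\<psi>] U(1) x]) (simp add: inv)
  then have "frechet_derivative \<psi> (at (\<phi> x)) \<circ> frechet_derivative \<phi> (at x) = (\<lambda>v. v)"
    using has_derivative_unique[OF _ has_derivative_ident] by blast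
  then show "frechet_derivative \<psi> (at (\<phi> x)) (frechet_derivative \<phi> (at x) v) = v"
    by (metis comp_apply)
  have "(\<phi> has_derivative frechet_derivative \<phi> (at x)) (at (\<psi> (\<phi> x)))"
    using d\<phi> by (simp add: inv x)
  from diff_chain_at[OF d\<psi> this]
  have "((\<lambda>z. z) has_derivative frechet_derivative \<phi> (at x) \<circ> frechet_derivative \<psi> (at (\<phi> x))) (at (\<phi> x))"
    by (rule has_derivative_transform_within_open[OF _ U(2) V]) (simp add: inv')
  then have "frechet_derivative \<phi> (at x) \<circ> frechet_derivative \<psi> (at (\<phi> x)) = (\<lambda>v. v)"
    using has_derivative_unique[OF _ has_derivative_ident] by blast
  then show "frechet_derivative \<phi> (at x) (frechet_derivative \<psi> (at (\<phi> x)) w) = w"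
    by (metis comp_apply)
qed

text \<open>The curve is the preimage under the chart of a straight segment in the slice
  hyperplane.\<close>

lemma chart_tangent_vector:
  fixes \<phi> \<psi> :: "'a::euclidean_space \<Rightarrow> 'a"
  assumes U: "open U" "open V" "homeomorphism U V \<phi> \<psi>" "smooth_on V \<psi>"
    and slice: "\<phi> ` (S \<inter> U) = {y \<in> V. y \<bullet> b = 0}"
    and x: "x \<in> S \<inter> U" and w: "w \<bullet> b = 0"
  shows "frechet_derivative \<psi> (at (\<phi> x)) w \<in> tangent_space S x"
proof -
  have inv: "\<psi> (\<phi> z) = z" if "z \<in> U" for z using U(3) that by (simp add: homeomorphism_def)
  have V: "\<phi> x \<in> V" "\<phi> x \<bullet> b = 0" using slice x by blast+
  obtain r where r: "r > 0" "ball (\<phi> x) r \<subseteq> V" using U(2) V open_contains_ball by blast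
  define \<epsilon> where "\<epsilon> = r / (norm w + 1)"
  have nw: "norm w + 1 > 0" by (simp add: add_nonneg_pos)
  have \<epsilon>: "\<epsilon> > 0" using r nw by (simp add: \<epsilon>_def)
  define \<gamma> where "\<gamma> = (\<lambda>t::real. \<psi> (\<phi> x + t *\<^sub>R w))"
  have inV: "\<phi> x + t *\<^sub>R w \<in> V" if "t \<in> {-\<epsilon><..<\<epsilon>}" for t
  proof -
    have "\<bar>t\<bar> * norm w \<le> \<bar>t\<bar> * (norm w + 1)" by (intro mult_left_mono) auto
    also have "\<dots> < \<epsilon> * (norm w + 1)" using that nw by (intro mult_strict_right_mono) auto
    also have "\<dots> = r" using nw by (simp add: \<epsilon>_def)
    finally show ?thesis using r(2) by (auto simp: dist_norm)
  qed
  have "\<gamma> t \<in> S" if "t \<in> {-\<epsilon><..<\<epsilon>}" for t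
  proof -
    have "\<phi> x + t *\<^sub>R w \<in> \<phi> ` (S \<inter> U)"
      unfolding slice using inV[OF that] V w by (simp add: inner_add_left)
    then show ?thesis using inv by (auto simp: \<gamma>_def)
  qed
  moreover have "smooth_on {-\<epsilon><..<\<epsilon>} \<gamma>"
    using U(4) inV unfolding smooth_on_def \<gamma>_def by (intro allI Ck_on_affine[of _ _ _ V]) auto
  moreover have "\<gamma> 0 = x" using x inv by (simp add: \<gamma>_def)
  moreover have "(\<gamma> has_vector_derivative frechet_derivative \<psi> (at (\<phi> x)) w) (at 0)"
  proof -
    have "((\<lambda>t. \<phi> x + t *\<^sub>R w) has_vector_derivative w) (at (0::real))"
      by (auto intro!: derivative_eq_intros)
    moreover have "(\<psi> has_derivative frechet_derivative \<psi> (at (\<phi> x))) (at (\<phi> x + 0 *\<^sub>R w) within (\<lambda>t::real. \<phi> x + t *\<^sub>R w) ` UNIV)"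
      using smooth_on_has_derivative[OF U(4) V(1)] by (auto intro: has_derivative_at_withinI)
    ultimately show ?thesis
      using vector_derivative_diff_chain_within[of "\<lambda>t. \<phi> x + t *\<^sub>R w" w 0 UNIV \<psi>]
      by (simp add: \<gamma>_def o_def)
  qed
  ultimately show ?thesis unfolding tangent_space_def using \<epsilon> by blast
qed

text \<open>\<open>tangent_space\<close> is a set of velocities, not a subspace by definition. It
  lies between the image of the slice hyperplane and the orthogonal complement of
  \<open>\<nu>\<close>; both have dimension \<open>DIM('a) - 1\<close>, so all three agree.\<close>

lemma chart_tangent_space:
  fixes \<phi> \<psi> :: "'a::euclidean_space \<Rightarrow> 'a"
  assumes U: "open U" "open V" "homeomorphism U V \<phi> \<psi>" "smooth_on U \<phi>" "smooth_on V \<psi>"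
    and slice: "\<phi> ` (S \<inter> U) = {y \<in> V. y \<bullet> b = 0}" and b: "b \<in> Basis"
    and x: "x \<in> S \<inter> U"
    and \<nu>: "norm \<nu> = 1" "\<And>v. v \<in> tangent_space S x \<Longrightarrow> \<nu> \<bullet> v = 0"
  shows "tangent_space S x = {v. \<nu> \<bullet> v = 0}"
    "frechet_derivative (\<lambda>y. \<phi> y \<bullet> b) (at x) \<nu> \<noteq> 0"
proof -
  have V: "\<phi> x \<in> V" using slice x by blast
  define L where "L = frechet_derivative \<psi> (at (\<phi> x))"
  define P where "P = frechet_derivative \<phi> (at x)"
  have linL: "linear L" unfolding L_def by (rule smooth_on_linear_frechet[OF U(5) V])
  have linP: "linear P" unfolding P_def using x by (intro smooth_on_linear_frechet[OF U(4)]) auto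
  have LP: "L (P v) = v" "P (L v) = v" for v
    using chart_derivatives[OF U] x unfolding L_def P_def by blast+
  let ?W = "{w. b \<bullet> w = 0}" and ?T = "{v. \<nu> \<bullet> v = 0}"
  have sub: "L ` ?W \<subseteq> tangent_space S x"
    using chart_tangent_vector[OF U(1-3,5) slice x] by (auto simp: L_def inner_commute)
  have T: "tangent_space S x \<subseteq> ?T" using \<nu>(2) by blast
  have "inj L" using LP(2) by (metis injI)
  then have "dim (L ` ?W) = DIM('a) - 1"
    using dim_image_eq[OF linL, of ?W] dim_hyperplane[of b] b nonzero_Basis[OF b]
    by (metis inj_on_subset subset_UNIV)
  moreover have "dim ?T = DIM('a) - 1" using \<nu>(1) by (intro dim_hyperplane) auto
  ultimately have eq: "L ` ?W = ?T"
    using sub T by (intro subspace_dim_equal linear_subspace_image[OF linL] subspace_hyperplane) auto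
  then show "tangent_space S x = ?T" using sub T by blast
  have df: "frechet_derivative (\<lambda>y. \<phi> y \<bullet> b) (at x) v = P v \<bullet> b" for v
    unfolding P_def using x
    by (intro frechet_eqI has_derivative_inner_left smooth_on_has_derivative[OF U(4)]) auto
  show "frechet_derivative (\<lambda>y. \<phi> y \<bullet> b) (at x) \<nu> \<noteq> 0"
  proof
    assume 0: "frechet_derivative (\<lambda>y. \<phi> y \<bullet> b) (at x) \<nu> = 0"
    \<comment> \<open>\<open>v\<close> is the tangential part of \<open>L b\<close>, so its chart
      image has no \<open>b\<close> component. If the derivative along \<open>\<nu>\<close>
      vanished, that component would be \<open>b \<bullet> b = 1\<close>.\<close>
    define v where "v = L b - (\<nu> \<bullet> L b) *\<^sub>R \<nu>"
    have "\<nu> \<bullet> v = 0" using \<nu>(1) by (simp add: v_def inner_diff_right dot_square_norm)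
    then obtain w where "b \<bullet> w = 0" "v = L w" using eq by blast
    then have "P v \<bullet> b = 0" by (simp add: LP inner_commute)
    moreover have "P v \<bullet> b = b \<bullet> b - (\<nu> \<bullet> L b) * (P \<nu> \<bullet> b)"
      by (simp add: v_def linear_diff[OF linP] linear_cmul[OF linP] LP inner_diff_left)
    ultimately show False using 0 b by (simp add: df)
  qed
qed

text \<open>The defining function is the \<open>b\<close> coordinate of a slice chart. The open set
  \<open>W\<close> lets the patch be confined to a given neighbourhood, later the interior of the
  large ball.\<close>

lemma hypersurface_patch_exists:
  fixes S :: "'a::euclidean_space set"
  assumes S: "smooth_hypersurface S" and \<nu>: "unit_normal_field S \<nu>"
    and p: "p \<in> S" "open W" "p \<in> W"
  shows "\<exists>U N f. hypersurface_patch S U N f \<and> p \<in> U \<and> U \<subseteq> W \<and> (\<forall>x\<in>S \<inter> U. N x = \<nu> x)"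
proof -
  define chart where "chart U V \<phi> \<psi> b \<longleftrightarrow> open U \<and> p \<in> U \<and> open V \<and> homeomorphism U V \<phi> \<psi> \<and>
      smooth_on U \<phi> \<and> smooth_on V \<psi> \<and> \<phi> ` (S \<inter> U) = {y \<in> V. y \<bullet> b = 0}"
    for U V :: "'a set" and \<phi> \<psi> :: "'a \<Rightarrow> 'a" and b
  have "\<exists>U V \<phi> \<psi>. \<exists>b\<in>Basis. chart U V \<phi> \<psi> b"
    unfolding chart_def by (rule bspec[OF S[unfolded smooth_hypersurface_def] p(1)])
  then obtain U0 V \<phi> \<psi> b where "chart U0 V \<phi> \<psi> b" and b: "b \<in> Basis" by blast
  then have c: "open U0" "p \<in> U0" "open V" "homeomorphism U0 V \<phi> \<psi>" "smooth_on U0 \<phi>"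
    "smooth_on V \<psi>" "\<phi> ` (S \<inter> U0) = {y \<in> V. y \<bullet> b = 0}"
    unfolding chart_def by blast+
  obtain U1 N where N: "open U1" "p \<in> U1" "smooth_on U1 N" "\<And>x. x \<in> S \<inter> U1 \<Longrightarrow> N x = \<nu> x"
    using \<nu> p(1) unfolding unit_normal_field_def smooth_along_def by metis
  define U where "U = U0 \<inter> U1 \<inter> W"
  have \<nu>1: "norm (N x) = 1" "\<And>v. v \<in> tangent_space S x \<Longrightarrow> N x \<bullet> v = 0" if "x \<in> S \<inter> U" for x
    using \<nu> N(4) that unfolding unit_normal_field_def U_def by auto
  have "hypersurface_patch S U N (\<lambda>y. \<phi> y \<bullet> b)"
  proof
    show U: "open U" unfolding U_def using c N p by blast
    show "smooth_on U N" using N(3) by (rule smooth_on_subset) (auto simp: U_def)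
    have "smooth_on U \<phi>" using c(5) by (rule smooth_on_subset) (auto simp: U_def)
    then show "smooth_on U (\<lambda>y. \<phi> y \<bullet> b)" by (intro smooth_intros U)
    fix x assume x: "x \<in> S \<inter> U"
    then have x0: "x \<in> S \<inter> U0" by (auto simp: U_def)
    show "N x \<bullet> N x = 1" using \<nu>1[OF x] by (simp add: dot_square_norm)
    show "tangent_space S x = {v. N x \<bullet> v = 0}" "frechet_derivative (\<lambda>y. \<phi> y \<bullet> b) (at x) (N x) \<noteq> 0"
      using chart_tangent_space[OF c(1,3-7) b x0 \<nu>1[OF x]] by blast+
    show "\<phi> x \<bullet> b = 0" using c(7) x0 by blast
  qed
  moreover have "p \<in> U" "U \<subseteq> W" "\<forall>x\<in>S \<inter> U. N x = \<nu> x"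
    using N(2,4) c(2) p(3) by (auto simp: U_def)
  ultimately show ?thesis by blast
qed

section \<open>Traces in adapted orthonormal frames\<close>

lemma orthonormal_trace:
  fixes L :: "'a::euclidean_space \<Rightarrow> 'a"
  assumes L: "linear L" and F: "\<And>v. (\<Sum>f\<in>F. (v \<bullet> f) *\<^sub>R f) = v"
  shows "(\<Sum>f\<in>F. L f \<bullet> f) = (\<Sum>k\<in>Basis. L k \<bullet> k)"
proof -
  have "(\<Sum>f\<in>F. L f \<bullet> f) = (\<Sum>f\<in>F. L (\<Sum>k\<in>Basis. (f \<bullet> k) *\<^sub>R k) \<bullet> f)"
    by (simp add: euclidean_representation)
  also have "\<dots> = (\<Sum>f\<in>F. \<Sum>k\<in>Basis. (f \<bullet> k) * (L k \<bullet> f))"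
    by (simp add: linear_sum[OF L] linear_cmul[OF L] inner_sum_left)
  also have "\<dots> = (\<Sum>k\<in>Basis. \<Sum>f\<in>F. (f \<bullet> k) * (L k \<bullet> f))"
    by (rule sum.swap)
  also have "\<dots> = (\<Sum>k\<in>Basis. L k \<bullet> (\<Sum>f\<in>F. (k \<bullet> f) *\<^sub>R f))"
    by (simp add: inner_sum_right inner_commute)
  finally show ?thesis by (simp add: F)
qed

text \<open>Parseval is applied to \<open>L\<close> to change the basis of the target and to its
  adjoint to change the basis of the source. The expansion identity expresses that \<open>F\<close>
  serves as an orthonormal basis.\<close>

lemma orthonormal_hilbert_schmidt:
  fixes L :: "'a::euclidean_space \<Rightarrow> 'a"
  assumes L: "linear L" and F: "\<And>v. (\<Sum>f\<in>F. (v \<bullet> f) *\<^sub>R f) = v"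
  shows "(\<Sum>e\<in>F. \<Sum>f\<in>F. (L e \<bullet> f)\<^sup>2) = (\<Sum>k\<in>Basis. \<Sum>l\<in>Basis. (L k \<bullet> l)\<^sup>2)"
proof -
  have pars: "(\<Sum>f\<in>F. (v \<bullet> f)\<^sup>2) = v \<bullet> v" for v
  proof -
    have "v \<bullet> v = v \<bullet> (\<Sum>f\<in>F. (v \<bullet> f) *\<^sub>R f)" by (simp only: F)
    then show ?thesis by (simp add: inner_sum_right power2_eq_square)
  qed
  have parsB: "(\<Sum>k\<in>Basis. (v \<bullet> k)\<^sup>2) = v \<bullet> v" for v :: 'a
    by (simp add: power2_eq_square euclidean_inner[of v v])
  have adj: "adjoint L f \<bullet> v = L v \<bullet> f" for f v
    by (metis adjoint_works[OF L] inner_commute)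
  have "(\<Sum>k\<in>Basis. \<Sum>l\<in>Basis. (L k \<bullet> l)\<^sup>2) = (\<Sum>k\<in>Basis. \<Sum>f\<in>F. (L k \<bullet> f)\<^sup>2)"
    by (simp add: pars parsB)
  also have "\<dots> = (\<Sum>f\<in>F. \<Sum>k\<in>Basis. (adjoint L f \<bullet> k)\<^sup>2)"
    unfolding adj by (rule sum.swap)
  also have "\<dots> = (\<Sum>f\<in>F. \<Sum>e\<in>F. (adjoint L f \<bullet> e)\<^sup>2)"
    by (simp add: pars parsB)
  also have "\<dots> = (\<Sum>e\<in>F. \<Sum>f\<in>F. (L e \<bullet> f)\<^sup>2)"
    unfolding adj by (rule sum.swap)
  finally show ?thesis ..
qed

lemma tangent_frame:
  assumes "subspace (tangent_space S x)"
  shows "orthonormal_basis (tangent_space S x) (tangent_frame S x)"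
proof -
  obtain B where "B \<subseteq> tangent_space S x" "pairwise orthogonal B" "\<And>x. x \<in> B \<Longrightarrow> norm x = 1" "span B = tangent_space S x"
    using orthonormal_basis_subspace[OF assms] by metis
  then have "orthonormal_basis (tangent_space S x) B" by (simp add: orthonormal_basis_def)
  then show ?thesis unfolding tangent_frame_def by (rule someI)
qed

context hypersurface_patch
begin

context
  fixes x \<nu>
  assumes x: "x \<in> S \<inter> U" and \<nu>: "\<And>y. y \<in> S \<inter> U \<Longrightarrow> \<nu> y = N y"
begin

text \<open>A derivative within \<open>S\<close> is not unique as a linear map. Composing with a
  curve in \<open>S\<close> of velocity \<open>v\<close> shows that all such derivatives agree on
  \<open>v\<close>.\<close>

lemma deriv_along_normal:
  assumes v: "N x \<bullet> v = 0"
  shows "deriv_along S \<nu> x v = frechet_derivative N (at x) v"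
proof -
  have N: "(N has_derivative frechet_derivative N (at x)) (at x)"
    using x by (intro smooth_on_has_derivative[OF smooth_N]) auto
  obtain r where r: "r > 0" "ball x r \<subseteq> U" using open_U x open_contains_ball by blast
  have d: "(\<nu> has_derivative frechet_derivative N (at x)) (at x within S)"
    by (rule has_derivative_transform_within[OF has_derivative_at_withinI[OF N] r(1)])
       (use x r(2) \<nu> in \<open>auto simp: dist_commute subset_iff\<close>)
  then have d': "(\<nu> has_derivative deriv_along S \<nu> x) (at x within S)"
    unfolding deriv_along_def using differentiableI frechet_derivative_works by blast
  have "v \<in> tangent_space S x" using tangent[OF x] v by simp
  then obtain \<epsilon> \<gamma> where \<gamma>: "\<epsilon> > 0" "\<gamma> ` {-\<epsilon><..<\<epsilon>} \<subseteq> S" "\<gamma> 0 = x" "(\<gamma> has_vector_derivative v) (at (0::real))"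
    unfolding tangent_space_def by blast
  have "((\<nu> \<circ> \<gamma>) has_vector_derivative A v) (at 0)" if "(\<nu> has_derivative A) (at x within S)" for A
  proof -
    have "((\<nu> \<circ> \<gamma>) has_vector_derivative A v) (at 0 within {-\<epsilon><..<\<epsilon>})"
      using has_derivative_subset[OF that \<gamma>(2)] \<gamma>(3)
      by (intro vector_derivative_diff_chain_within has_vector_derivative_at_within[OF \<gamma>(4)]) simp
    then show ?thesis using \<gamma>(1) by (simp add: at_within_open[of 0 "{-\<epsilon><..<\<epsilon>}"])
  qed
  from vector_derivative_unique_at[OF this[OF d'] this[OF d]] show ?thesis .
qed

lemma frame_expansion:
  shows "N x \<notin> tangent_frame S x" "finite (tangent_frame S x)"
    "\<And>e. e \<in> tangent_frame S x \<Longrightarrow> N x \<bullet> e = 0"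
    "(\<Sum>f\<in>insert (N x) (tangent_frame S x). (v \<bullet> f) *\<^sub>R f) = v"
proof -
  have "subspace (tangent_space S x)" unfolding tangent[OF x] by (rule subspace_hyperplane)
  then have E: "tangent_frame S x \<subseteq> {v. N x \<bullet> v = 0}" "span (tangent_frame S x) = {v. N x \<bullet> v = 0}"
    "pairwise orthogonal (tangent_frame S x)" "\<And>e. e \<in> tangent_frame S x \<Longrightarrow> norm e = 1"
    using tangent_frame[of S x] unfolding orthonormal_basis_def tangent[OF x] by auto
  show 0: "N x \<bullet> e = 0" if "e \<in> tangent_frame S x" for e using E(1) that by blast
  show N: "N x \<notin> tangent_frame S x" using 0[of "N x"] N1[OF x] by auto
  have "0 \<notin> tangent_frame S x" using E(4)[of 0] by auto
  then have "independent (tangent_frame S x)" by (rule pairwise_orthogonal_independent[OF E(3)])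
  then show fin: "finite (tangent_frame S x)" by (rule independent_imp_finite)
  have "v - (v \<bullet> N x) *\<^sub>R N x \<in> span (tangent_frame S x)"
    unfolding E(2) using N1[OF x] by (simp add: inner_diff_right inner_commute)
  from orthonormal_basis_expand[OF E(3,4) this fin]
  have "(\<Sum>f\<in>tangent_frame S x. (v \<bullet> f) *\<^sub>R f) = v - (v \<bullet> N x) *\<^sub>R N x"
    using 0 by (simp add: inner_diff_left)
  then show "(\<Sum>f\<in>insert (N x) (tangent_frame S x). (v \<bullet> f) *\<^sub>R f) = v"
    using N fin by simp
qed

text \<open>\<open>L\<close> extends the shape operator by zero in the normal direction and has
  tangential values. Adding \<open>N x\<close> to the frame thus changes neither trace nor norm,
  which can then be computed in the ambient basis.\<close>

lemma shape_operator:
  defines "L \<equiv> \<lambda>v. frechet_derivative N (at x) (proj x v)"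
  shows "linear L" "L (N x) = 0" "L v \<bullet> N x = 0" "h i j x = L i \<bullet> j"
    "e \<in> tangent_frame S x \<Longrightarrow> deriv_along S \<nu> x e = L e"
proof -
  have lin: "linear (frechet_derivative N (at x))"
    using x by (intro smooth_on_linear_frechet[OF smooth_N]) auto
  show "linear L"
    by (rule linearI) (simp_all add: L_def proj_def linear_add[OF lin] linear_diff[OF lin]
        linear_cmul[OF lin] algebra_simps inner_add_right)
  show "L (N x) = 0" using N1[OF x] linear_0[OF lin] by (simp add: L_def proj_def)
  show *: "h i j x = L i \<bullet> j" for i j using h_eq x by (simp add: L_def)
  show "L v \<bullet> N x = 0" using h_N[OF x, of v] by (simp add: *)
  show "deriv_along S \<nu> x e = L e" if "e \<in> tangent_frame S x"
    using frame_expansion(3)[OF that] by (simp add: deriv_along_normal L_def proj_def)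
qed

lemma mean_curvature_eq: "mean_curvature S \<nu> x = H x"
proof -
  define L where "L v = frechet_derivative N (at x) (proj x v)" for v
  note L = shape_operator[folded L_def]
  have "mean_curvature S \<nu> x = (\<Sum>e\<in>tangent_frame S x. L e \<bullet> e)"
    unfolding mean_curvature_def div_along_def by (intro sum.cong refl) (simp add: L)
  also have "\<dots> = (\<Sum>e\<in>insert (N x) (tangent_frame S x). L e \<bullet> e)"
    using frame_expansion(1,2) by (simp add: L(2))
  also have "\<dots> = (\<Sum>k\<in>Basis. L k \<bullet> k)"
    by (rule orthonormal_trace[OF L(1) frame_expansion(4)])
  finally show ?thesis by (simp add: H_def L)
qed

lemma norm_second_ff_eq: "(norm_second_ff S \<nu> x)\<^sup>2 = a x"
proof -
  define L where "L v = frechet_derivative N (at x) (proj x v)" for v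
  note L = shape_operator[folded L_def]
  have "(norm_second_ff S \<nu> x)\<^sup>2 = (\<Sum>e\<in>tangent_frame S x. \<Sum>f\<in>tangent_frame S x. (second_ff S \<nu> x e f)\<^sup>2)"
    unfolding norm_second_ff_def by (simp add: sum_nonneg)
  also have "\<dots> = (\<Sum>e\<in>tangent_frame S x. \<Sum>f\<in>tangent_frame S x. (L e \<bullet> f)\<^sup>2)"
    by (intro sum.cong refl) (simp add: L second_ff_def)
  also have "\<dots> = (\<Sum>e\<in>insert (N x) (tangent_frame S x). \<Sum>f\<in>insert (N x) (tangent_frame S x). (L e \<bullet> f)\<^sup>2)"
    using frame_expansion(1,2) by (simp add: L(2,3))
  also have "\<dots> = (\<Sum>k\<in>Basis. \<Sum>l\<in>Basis. (L k \<bullet> l)\<^sup>2)"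
    by (rule orthonormal_hilbert_schmidt[OF L(1) frame_expansion(4)])
  finally show ?thesis by (simp add: a_def L)
qed

end

end

section \<open>From patches to the global estimate\<close>

lemma norm_second_ff_nonneg: "norm_second_ff S \<nu> x \<ge> 0"
  by (simp add: norm_second_ff_def sum_nonneg)

lemma shrinker_patch_exists:
  fixes S :: "'a::euclidean_space set"
  assumes S: "smooth_hypersurface S" and \<nu>: "unit_normal_field S \<nu>" and sh: "self_shrinker S \<nu>"
    and p: "p \<in> S" "open W" "p \<in> W"
  shows "\<exists>U N f. shrinker_patch S U N f \<and> p \<in> U \<and> U \<subseteq> W \<and>
    (\<forall>x\<in>S \<inter> U. mean_curvature S \<nu> x = hypersurface_patch.H N x \<and>
      (norm_second_ff S \<nu> x)\<^sup>2 = hypersurface_patch.a N x)"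
proof -
  obtain U N f where P: "hypersurface_patch S U N f" "p \<in> U" "U \<subseteq> W" "\<And>x. x \<in> S \<inter> U \<Longrightarrow> N x = \<nu> x"
    using hypersurface_patch_exists[OF S \<nu> p] by blast
  interpret hypersurface_patch S U N f by (rule P(1))
  have H: "mean_curvature S \<nu> x = H x" if "x \<in> S \<inter> U" for x
    using mean_curvature_eq[OF that] P(4) by simp
  have "shrinker_patch S U N f"
  proof
    fix x assume x: "x \<in> S \<inter> U"
    then have "mean_curvature S \<nu> x = x \<bullet> \<nu> x / 2" using sh by (simp add: self_shrinker_def)
    then show "(\<Sum>k\<in>Basis. h k k x) = x \<bullet> N x / 2"
      unfolding H[OF x] P(4)[OF x] by (simp add: H_def)
  qed
  moreover have "(norm_second_ff S \<nu> x)\<^sup>2 = a x" if "x \<in> S \<inter> U" for x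
    using norm_second_ff_eq[OF that] P(4) by simp
  ultimately show ?thesis using P(2,3) H by blast
qed

text \<open>Properness makes the domain compact, and the lower bound on the mean curvature keeps the
  denominator away from zero. The weighted quotient therefore attains its maximum, where the local
  estimate applies.\<close>

lemma weighted_curvature_bound:
  fixes S :: "'a::euclidean_space set"
  assumes S: "smooth_hypersurface S" "properly_embedded S" "unit_normal_field S \<nu>" "self_shrinker S \<nu>"
    and c: "c > 0" and R: "R \<ge> 1"
    and H: "\<And>x. x \<in> S \<inter> cball 0 R \<Longrightarrow> mean_curvature S \<nu> x \<ge> 2 * c"
    and x: "x \<in> S \<inter> cball 0 R"
  shows "(norm_second_ff S \<nu> x)\<^sup>2 * (R\<^sup>2 - x \<bullet> x)\<^sup>2 / (mean_curvature S \<nu> x - c)\<^sup>2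
    \<le> (4 * real DIM('a) + 17 + 4 / c\<^sup>2) / c\<^sup>2 * R ^ 4"
proof -
  define X where "X x = (norm_second_ff S \<nu> x)\<^sup>2 * (R\<^sup>2 - x \<bullet> x)\<^sup>2 / (mean_curvature S \<nu> x - c)\<^sup>2" for x
  have comp: "compact (S \<inter> cball 0 R)" using S(2) by (simp add: properly_embedded_def)
  have cont: "continuous_on (S \<inter> cball 0 R) X"
    unfolding continuous_on_eq_continuous_within
  proof
    fix p assume p: "p \<in> S \<inter> cball 0 R"
    then have "p \<in> S" by simp
    obtain U N f where P: "shrinker_patch S U N f" "p \<in> U" "U \<subseteq> UNIV"
      "\<And>x. x \<in> S \<inter> U \<Longrightarrow> mean_curvature S \<nu> x = hypersurface_patch.H N x"
      "\<And>x. x \<in> S \<inter> U \<Longrightarrow> (norm_second_ff S \<nu> x)\<^sup>2 = hypersurface_patch.a N x"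
      using shrinker_patch_exists[OF S(1,3,4) \<open>p \<in> S\<close> open_UNIV UNIV_I] by blast
    interpret shrinker_patch S U N f by (rule P(1))
    have "isCont a p" "isCont H p"
      using smooth_on_imp_continuous_on[OF smooth_a] smooth_on_imp_continuous_on[OF smooth_H] P(2) open_U
      by (auto simp: continuous_on_eq_continuous_at)
    moreover have "H p - c \<noteq> 0" using H[OF p] P(4)[of p] p P(2) c by auto
    ultimately have "isCont (\<lambda>y. a y * (R\<^sup>2 - y \<bullet> y)\<^sup>2 / (H y - c)\<^sup>2) p"
      by (intro continuous_intros) auto
    then have "continuous (at p within S \<inter> cball 0 R) (\<lambda>y. a y * (R\<^sup>2 - y \<bullet> y)\<^sup>2 / (H y - c)\<^sup>2)"
      by (rule continuous_at_imp_continuous_within)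
    note cont = this
    obtain r where r: "r > 0" "ball p r \<subseteq> U" using open_U P(2) open_contains_ball by blast
    show "continuous (at p within S \<inter> cball 0 R) X"
    proof (rule continuous_transform_within[OF cont r(1) p])
      fix y assume y: "y \<in> S \<inter> cball 0 R" "dist y p < r"
      then have "y \<in> S \<inter> U" using r(2) by (auto simp: dist_commute)
      then show "a y * (R\<^sup>2 - y \<bullet> y)\<^sup>2 / (H y - c)\<^sup>2 = X y" by (simp add: X_def P)
    qed
  qed
  obtain p where p: "p \<in> S \<inter> cball 0 R" "\<And>y. y \<in> S \<inter> cball 0 R \<Longrightarrow> X y \<le> X p"
    using continuous_attains_sup[OF comp _ cont] x by blast
  have "X p \<le> (4 * real DIM('a) + 17 + 4 / c\<^sup>2) / c\<^sup>2 * R ^ 4"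
  \<comment> \<open>On the bounding sphere the cutoff vanishes. Inside, the patch is chosen in the
    open ball, so that \<open>p\<close> is maximal among all points of \<open>S\<close> in the
    patch.\<close>
  proof (cases "norm p < R")
    case False
    then have "norm p = R" using p(1) by simp
    then have "X p = 0" by (simp add: X_def dot_square_norm)
    then show ?thesis using c by (simp add: divide_nonneg_pos add_nonneg_nonneg)
  next
    case True
    obtain U N f where P: "shrinker_patch S U N f" "p \<in> U" "U \<subseteq> ball 0 R"
      "\<And>x. x \<in> S \<inter> U \<Longrightarrow> mean_curvature S \<nu> x = hypersurface_patch.H N x"
      "\<And>x. x \<in> S \<inter> U \<Longrightarrow> (norm_second_ff S \<nu> x)\<^sup>2 = hypersurface_patch.a N x"
    proof -
      have "p \<in> S" "p \<in> ball 0 R" using p True by auto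
      then show thesis using shrinker_patch_exists[OF S(1,3,4) _ open_ball] that by blast
    qed
    interpret shrinker_patch S U N f by (rule P(1))
    have pU: "p \<in> S \<inter> U" using p P by auto
    have HK: "H y - c \<ge> c" if "y \<in> S \<inter> U" for y
      using H[of y] P(4)[OF that] that P(3) by auto
    have XU: "X y = a y * (R\<^sup>2 - y \<bullet> y)\<^sup>2 / (H y - c)\<^sup>2" if "y \<in> S \<inter> U" for y
      using P that by (simp add: X_def)
    show ?thesis
    proof (rule max_point_bound[OF pU c HK[OF pU] R _ XU[OF pU]])
      show "p \<bullet> p < R\<^sup>2" using True R by (simp add: dot_square_norm power_strict_mono)
      fix y assume y: "y \<in> S \<inter> U"
      then have "y \<in> S \<inter> cball 0 R" using P(3) by auto
      then have "a y * (R\<^sup>2 - y \<bullet> y)\<^sup>2 / (H y - c)\<^sup>2 \<le> X p" using p(2) XU[OF y] by metis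
      moreover have "(H y - c)\<^sup>2 > 0" using HK[OF y] c by simp
      ultimately show "a y * (R\<^sup>2 - y \<bullet> y)\<^sup>2 \<le> X p * (H y - c)\<^sup>2"
        by (simp add: pos_divide_le_eq)
    qed
  qed
  then show ?thesis using p(2)[OF x] by (simp add: X_def)
qed

theorem theorem1p1:
  fixes n :: nat and \<delta> :: real
  assumes "n \<ge> 2" and "\<delta> > 0" and "DIM('a::euclidean_space) = n + 1"
  shows "\<exists>C::real. \<forall>(R::real) (\<Sigma>::'a set) (\<nu>::'a \<Rightarrow> 'a).
    R > 2 \<longrightarrow>
    smooth_hypersurface \<Sigma> \<longrightarrow> properly_embedded \<Sigma> \<longrightarrow>
    unit_normal_field \<Sigma> \<nu> \<longrightarrow> self_shrinker \<Sigma> \<nu> \<longrightarrow>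
    (\<forall>x \<in> cball 0 R \<inter> \<Sigma>. mean_curvature \<Sigma> \<nu> x \<ge> \<delta>) \<longrightarrow>
    (\<forall>x \<in> cball 0 (R - 1) \<inter> \<Sigma>.
       norm_second_ff \<Sigma> \<nu> x \<le> C * R / (R - norm x) * mean_curvature \<Sigma> \<nu> x)"
proof -
  \<comment> \<open>With this choice the hypothesis on the mean curvature gives both
    \<open>H > c\<close> and \<open>H - c \<ge> c\<close>.\<close>
  define c where "c = \<delta> / 2"
  define B where "B = (4 * real DIM('a) + 17 + 4 / c\<^sup>2) / c\<^sup>2"
  have c: "c > 0" using assms(2) by (simp add: c_def)
  have B: "B \<ge> 0" using c by (simp add: B_def)
  have "norm_second_ff \<Sigma> \<nu> x \<le> sqrt B * R / (R - norm x) * mean_curvature \<Sigma> \<nu> x"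
    if R: "R > 2" and S: "smooth_hypersurface \<Sigma>" "properly_embedded \<Sigma>" "unit_normal_field \<Sigma> \<nu>" "self_shrinker \<Sigma> \<nu>"
      and H: "\<forall>x \<in> cball 0 R \<inter> \<Sigma>. mean_curvature \<Sigma> \<nu> x \<ge> \<delta>"
      and x: "x \<in> cball 0 (R - 1) \<inter> \<Sigma>" for R \<Sigma> \<nu> and x :: 'a
  proof -
    define A K \<eta> where "A = norm_second_ff \<Sigma> \<nu> x" and "K = mean_curvature \<Sigma> \<nu> x - c" and "\<eta> = R\<^sup>2 - x \<bullet> x"
    have xR: "x \<in> \<Sigma> \<inter> cball 0 R" "norm x < R" using x by auto
    have "mean_curvature \<Sigma> \<nu> x \<ge> \<delta>" using H xR by auto
    then have K: "K > 0" "K \<le> mean_curvature \<Sigma> \<nu> x" using assms(2) by (auto simp: K_def c_def)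
    have "A\<^sup>2 * \<eta>\<^sup>2 / K\<^sup>2 \<le> B * R ^ 4"
      unfolding A_def K_def \<eta>_def B_def
      by (rule weighted_curvature_bound[OF S c _ _ xR(1)]) (use R H in \<open>auto simp: c_def\<close>)
    then have "(A * \<eta>)\<^sup>2 \<le> B * R ^ 4 * K\<^sup>2"
      using K by (simp add: pos_divide_le_eq power_mult_distrib)
    also have "\<dots> = (sqrt B * R\<^sup>2 * K)\<^sup>2" using B by (simp add: power_mult_distrib flip: power_mult)
    finally have 1: "A * \<eta> \<le> sqrt B * R\<^sup>2 * K"
      by (rule power2_le_imp_le) (use B K in simp)
    \<comment> \<open>The cutoff factors as \<open>(R + norm x) * (R - norm x)\<close>. This is why
      the bound is linear in \<open>R - norm x\<close>: one factor \<open>R\<close> is cancelled at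
      the end.\<close>
    have "R * (R - norm x) \<le> \<eta>"
    proof -
      have "\<eta> = (R + norm x) * (R - norm x)"
        by (simp add: \<eta>_def dot_square_norm power2_eq_square algebra_simps)
      then show ?thesis using xR R by (simp add: mult_right_mono)
    qed
    then have "A * (R * (R - norm x)) \<le> A * \<eta>"
      using norm_second_ff_nonneg[of \<Sigma> \<nu> x] by (intro mult_left_mono) (auto simp: A_def)
    also note 1
    also have "sqrt B * R\<^sup>2 * K \<le> sqrt B * R\<^sup>2 * mean_curvature \<Sigma> \<nu> x"
      using B K by (intro mult_left_mono) auto
    finally have "R * (A * (R - norm x)) \<le> R * (sqrt B * R * mean_curvature \<Sigma> \<nu> x)"
      by (simp add: power2_eq_square mult_ac)
    then have "A * (R - norm x) \<le> sqrt B * R * mean_curvature \<Sigma> \<nu> x" using R by simp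
    then show ?thesis using xR(2) by (simp add: A_def pos_le_divide_eq)
  qed
  then show ?thesis by blast
qed

end
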